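(* Let $n,d\ge 1$ and let $A(\lambda,\mu)=\sum_{i=0}^dA_i\lambda^i\mu^{d-i}$, $A_i\in\mathbb{C}^{n\times n}$, be a nonsingular matrix polynomial; write $\mathcal{A}=\begin{bmatrix} A_0 \\ A_1 \\ \vdots \\ A_d \end{bmatrix}\in\mathbb{C}^{(d+1)n\times n}$. Let $W\in\mathbb{C}^{dn\times(d+1)n}$ have full row rank with $W\mathcal{A}=0$, and let $V\in\mathbb{C}^{n\times(d+1)n}$, $B\in\mathbb{C}^{(d+1)n\times dn}$ be such that $\begin{bmatrix} V \\ W \end{bmatrix}\begin{bmatrix}\mathcal{A}&B\end{bmatrix}=I_{(d+1)n}$. Put $W_0=W\begin{bmatrix} 0_{n\times dn} \\ I_{dn} \end{bmatrix}$, $W_1=W\begin{bmatrix} I_{dn} \\ 0_{n\times dn} \end{bmatrix}$ and $W(\lambda,\mu)=\mu W_0-\lambda W_1$. Let $(\lambda,\mu)\in\mathbb{C}^2$ with $|\lambda|^2+|\mu|^2=1$ be a simple eigenvalue of $A$, with right and left eigenvectors $x,y\in\mathbb{C}^n\setminus\{0\}$, i.e. $A(\lambda,\mu)x=0$ and $y^*A(\lambda,\mu)=0$. Then $$\kappa_W(\lambda,\mu)\le\left(|\lambda|^2\|W_1\|^2+|\mu|^2\|W_0\|^2\right)^{1/2}\sqrt2\,T(d)\,\big\||\Lambda|_{\lambda,\mu}\big\|\,\|\mathcal{A}\|\,\|B\|\,\frac{\|x\|\|y\|}{\left|y^*\left(\bar\mu D_\lambda A-\bar\lambda D_\mu A\right)\big|_{(\lambda,\mu)}x\right|}.$$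 If moreover $W$ has orthonormal rows, then $$\kappa_W(\lambda,\mu)\le\sqrt2\,T(d)\,\big\||\Lambda|_{\lambda,\mu}\big\|\,\|\mathcal{A}\|\,\frac{\|x\|\|y\|}{\left|y^*\left(\bar\mu D_\lambda A-\bar\lambda D_\mu A\right)\big|_{(\lambda,\mu)}x\right|}.$$
   Context: All norms are Euclidean vector norms and the induced spectral matrix norms. $A(\lambda,\mu)$ is nonsingular if $\det A(\lambda,\mu)$ is not identically zero; a pair $(\lambda,\mu)\ne(0,0)$ (up to scaling) is a simple eigenvalue if it is a simple root of the homogeneous polynomial $\det A(\lambda,\mu)$. $D_\lambda A$ and $D_\mu A$ denote the partial derivatives of $A(\lambda,\mu)$ with respect to $\lambda$ and $\mu$. The eigenvalue condition number of the pencil $W(\lambda,\mu)=\mu W_0-\lambda W_1$ at the simple eigenvalue $(\lambda,\mu)$ is $$\kappa_W(\lambda,\mu)=\left(|\lambda|^2\|W_1\|^2+|\mu|^2\|W_0\|^2\right)^{1/2}\frac{\|\check x\|\|\check y\|}{\left|\check y^*\left(\bar\mu W_1+\bar\lambda W_0\right)\check x\right|},$$ where $\check x,\check y\in\mathbb{C}^{dn}\setminus\{0\}$ satisfy $W(\lambda,\mu)\check x=0$, $\check y^*W(\lambda,\mu)=0$ (these are unique up to scaling, and $\kappa_W$ does not depend on the scaling). $T(d)$ is the spectral norm of the $d\times d$ upper triangular matrix whose entries on and above the diagonal are all equal to $1$, and $|\Lambda|_{\lambda,\mu}:=\begin{bmatrix}|\lambda|^d&|\lambda|^{d-1}|\mu|&\cdots&|\mu|^d\end{bmatrix}$.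 *)

theory Defs
  imports
    "HOL-Analysis.Derivative"
    "Jordan_Normal_Form.Matrix"
    "Jordan_Normal_Form.Determinant"
    "Jordan_Normal_Form.DL_Rank"
begin

definition vec_norm2 :: "complex vec \<Rightarrow> real" where
  "vec_norm2 v = sqrt (\<Sum>i<dim_vec v. (cmod (v $ i))\<^sup>2)"

definition spectral_norm :: "complex mat \<Rightarrow> real" where
  "spectral_norm M = Sup {vec_norm2 (M *\<^sub>v v) |v. v \<in> carrier_vec (dim_col M) \<and> vec_norm2 v \<le> 1}"

definition append_cols :: "'a :: zero mat \<Rightarrow> 'a mat \<Rightarrow> 'a mat" (infixr "@\<^sub>c" 65) where
  "M @\<^sub>c N = four_block_mat M N (0\<^sub>m 0 (dim_col M)) (0\<^sub>m 0 (dim_col N))"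

definition bilin :: "complex vec \<Rightarrow> complex mat \<Rightarrow> complex vec \<Rightarrow> complex" where
  \<comment> \<open>\<open>y\<^sup>* M x\<close>\<close>
  "bilin y M x = (M *\<^sub>v x) \<bullet>c y"

definition right_eigenvector :: "complex mat \<Rightarrow> complex vec \<Rightarrow> bool" where
  "right_eigenvector M x \<longleftrightarrow>
     x \<in> carrier_vec (dim_col M) \<and> x \<noteq> 0\<^sub>v (dim_col M) \<and> M *\<^sub>v x = 0\<^sub>v (dim_row M)"

definition left_eigenvector :: "complex mat \<Rightarrow> complex vec \<Rightarrow> bool" where
  "left_eigenvector M y \<longleftrightarrow>
     y \<in> carrier_vec (dim_row M) \<and> y \<noteq> 0\<^sub>v (dim_row M) \<and>
     mat_of_row (conjugate y) * M = 0\<^sub>m 1 (dim_col M)"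

text \<open>A homogeneous matrix polynomial of grade \<open>d\<close> is given by its coefficients
  \<open>A 0, \<dots>, A d\<close>, each of size \<open>n \<times> n\<close>; here \<open>A i\<close> is the coefficient of
  \<open>\<lambda>\<^sup>i \<mu>\<^sup>d\<^sup>-\<^sup>i\<close>.\<close>

definition mpoly_eval :: "nat \<Rightarrow> nat \<Rightarrow> (nat \<Rightarrow> complex mat) \<Rightarrow> complex \<Rightarrow> complex \<Rightarrow> complex mat" where
  "mpoly_eval n d A lam mu = mat n n (\<lambda>(r, c). \<Sum>i\<le>d. (A i $$ (r, c)) * lam ^ i * mu ^ (d - i))"

definition nonsingular_mpoly :: "nat \<Rightarrow> nat \<Rightarrow> (nat \<Rightarrow> complex mat) \<Rightarrow> bool" where
  "nonsingular_mpoly n d A \<longleftrightarrow> (\<exists>lam mu. det (mpoly_eval n d A lam mu) \<noteq> 0)"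

text \<open>\<open>det A(\<lambda>, \<mu>)\<close> as a formal bivariate polynomial: the outer variable is \<open>\<lambda>\<close>, the
  inner one is \<open>\<mu>\<close>.\<close>

definition mpoly_det :: "nat \<Rightarrow> nat \<Rightarrow> (nat \<Rightarrow> complex mat) \<Rightarrow> complex poly poly" where
  "mpoly_det n d A =
     det (mat n n (\<lambda>(r, c). \<Sum>i\<le>d. monom (monom (A i $$ (r, c)) (d - i)) i))"

lemma poly_mpoly_det:
  "poly (poly (mpoly_det n d A) [:lam:]) mu = det (mpoly_eval n d A lam mu)"
proof -
  interpret h: comm_ring_hom "\<lambda>p :: complex poly poly. poly (poly p [:lam:]) mu"
    by unfold_locales auto
  have "map_mat (\<lambda>p. poly (poly p [:lam:]) mu)
      (mat n n (\<lambda>(r, c). \<Sum>i\<le>d. monom (monom (A i $$ (r, c)) (d - i)) i))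
      = mpoly_eval n d A lam mu"
    by (rule eq_matI)
      (simp_all add: mpoly_eval_def poly_sum poly_monom poly_const_pow mult.assoc mult.commute mult.left_commute)
  then show ?thesis
    unfolding mpoly_det_def by (simp flip: h.hom_det)
qed

text \<open>A root \<open>(\<lambda>\<^sub>0, \<mu>\<^sub>0) \<noteq> (0, 0)\<close> of a homogeneous polynomial corresponds to its linear factor
  \<open>\<mu>\<^sub>0 \<lambda> - \<lambda>\<^sub>0 \<mu>\<close>, and the root is simple iff this factor occurs exactly once. This covers
  infinite eigenvalues (\<open>\<mu>\<^sub>0 = 0\<close>).\<close>

definition simple_hom_root :: "complex poly poly \<Rightarrow> complex \<Rightarrow> complex \<Rightarrow> bool" where
  "simple_hom_root p lam mu \<longleftrightarrow> (lam, mu) \<noteq> (0, 0) \<and>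
     (let l = [: [:0, - lam:], [:mu:] :] in l dvd p \<and> \<not> l ^ 2 dvd p)"

definition simple_eigenvalue :: "nat \<Rightarrow> nat \<Rightarrow> (nat \<Rightarrow> complex mat) \<Rightarrow> complex \<Rightarrow> complex \<Rightarrow> bool" where
  "simple_eigenvalue n d A lam mu \<longleftrightarrow> simple_hom_root (mpoly_det n d A) lam mu"

definition D_lam :: "nat \<Rightarrow> nat \<Rightarrow> (nat \<Rightarrow> complex mat) \<Rightarrow> complex \<Rightarrow> complex \<Rightarrow> complex mat" where
  "D_lam n d A lam mu = mat n n (\<lambda>rc. deriv (\<lambda>z. mpoly_eval n d A z mu $$ rc) lam)"

definition D_mu :: "nat \<Rightarrow> nat \<Rightarrow> (nat \<Rightarrow> complex mat) \<Rightarrow> complex \<Rightarrow> complex \<Rightarrow> complex mat" where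
  "D_mu n d A lam mu = mat n n (\<lambda>rc. deriv (\<lambda>z. mpoly_eval n d A lam z $$ rc) mu)"

definition coeff_column :: "nat \<Rightarrow> nat \<Rightarrow> (nat \<Rightarrow> complex mat) \<Rightarrow> complex mat" where
  "coeff_column n d A = mat ((d + 1) * n) n (\<lambda>(r, c). A (r div n) $$ (r mod n, c))"

definition pencil_W0 :: "nat \<Rightarrow> nat \<Rightarrow> complex mat \<Rightarrow> complex mat" where
  "pencil_W0 n d W = W * (0\<^sub>m n (d * n) @\<^sub>r 1\<^sub>m (d * n))"

definition pencil_W1 :: "nat \<Rightarrow> nat \<Rightarrow> complex mat \<Rightarrow> complex mat" where
  "pencil_W1 n d W = W * (1\<^sub>m (d * n) @\<^sub>r 0\<^sub>m n (d * n))"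

text \<open>The pencil \<open>\<mu> W0 - \<lambda> W1\<close> is the matrix polynomial of grade 1 with the following
  coefficients.\<close>

definition pencil_coeffs :: "complex mat \<Rightarrow> complex mat \<Rightarrow> nat \<Rightarrow> complex mat" where
  "pencil_coeffs W0 W1 i = (if i = 0 then W0 else - W1)"

lemma mpoly_eval_pencil_coeffs:
  assumes "W0 \<in> carrier_mat N N" "W1 \<in> carrier_mat N N"
  shows "mpoly_eval N 1 (pencil_coeffs W0 W1) lam mu = mu \<cdot>\<^sub>m W0 - lam \<cdot>\<^sub>m W1"
  using assms by (intro eq_matI) (auto simp: mpoly_eval_def pencil_coeffs_def)

definition pencil_weight :: "complex mat \<Rightarrow> complex mat \<Rightarrow> complex \<Rightarrow> complex \<Rightarrow> real" where
  "pencil_weight W0 W1 lam mu =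
     sqrt ((cmod lam)\<^sup>2 * (spectral_norm W1)\<^sup>2 + (cmod mu)\<^sup>2 * (spectral_norm W0)\<^sup>2)"

text \<open>The condition number is a definite description over all choices of eigenvectors, with the
  simplicity of the eigenvalue and the nonvanishing of the denominator as part of the description:
  no value can be derived for it from the convention \<open>t / 0 = 0\<close>.\<close>

definition eigenvalue_cond :: "complex mat \<Rightarrow> complex mat \<Rightarrow> complex \<Rightarrow> complex \<Rightarrow> real" where
  "eigenvalue_cond W0 W1 lam mu = (THE k.
     simple_eigenvalue (dim_row W0) 1 (pencil_coeffs W0 W1) lam mu \<and>
     (\<exists>x y. right_eigenvector (mu \<cdot>\<^sub>m W0 - lam \<cdot>\<^sub>m W1) x \<and>
            left_eigenvector (mu \<cdot>\<^sub>m W0 - lam \<cdot>\<^sub>m W1) y \<and>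
            bilin y (cnj mu \<cdot>\<^sub>m W1 + cnj lam \<cdot>\<^sub>m W0) x \<noteq> 0 \<and>
            k = pencil_weight W0 W1 lam mu *
                (vec_norm2 x * vec_norm2 y / cmod (bilin y (cnj mu \<cdot>\<^sub>m W1 + cnj lam \<cdot>\<^sub>m W0) x))))"

definition tri_norm :: "nat \<Rightarrow> real" where
  "tri_norm d = spectral_norm (mat d d (\<lambda>(i, j). if i \<le> j then 1 else 0))"

definition abs_Lambda :: "nat \<Rightarrow> complex \<Rightarrow> complex \<Rightarrow> complex vec" where
  "abs_Lambda d lam mu = vec (d + 1) (\<lambda>i. complex_of_real (cmod lam ^ (d - i) * cmod mu ^ i))"

definition orthonormal_rows :: "complex mat \<Rightarrow> bool" where
  "orthonormal_rows M \<longleftrightarrow>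
     (\<forall>i < dim_row M. \<forall>j < dim_row M. row M i \<bullet>c row M j = (if i = j then 1 else 0))"

end

theory Submission
  imports Defs
begin

text \<open>Write \<open>C\<close> for the column of coefficients, \<open>G = \<mu> (0; I) - \<lambda> (I; 0)\<close>, so that the pencil is
  \<open>W G\<close>, and \<open>L\<close> for the block row \<open>(\<lambda>\<^sup>i \<mu>\<^sup>d\<^sup>-\<^sup>i I)\<^sub>i\<close>. Everything rests on the two relations
  \<open>L G = 0\<close> and \<open>L C = A(\<lambda>, \<mu>)\<close>.

  Eigenvectors of the pencil are built explicitly from \<open>x\<close> and \<open>y\<close>. The kernel of \<open>W\<close> contains the
  range of \<open>C\<close>, so a solution \<open>v\<close> of \<open>G v = C x\<close> is a right eigenvector; it exists because
  \<open>L C x = A(\<lambda>, \<mu>) x = 0\<close>. In each position inside the blocks the system is scalar and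
  bidiagonal. Substitution that starts from the end where the larger of \<open>\<bar>\<lambda>\<bar>\<close>, \<open>\<bar>\<mu>\<bar>\<close> is the pivot never
  amplifies a term, so a triangular matrix of ones dominates it, and the pivot is at least
  \<open>1 / sqrt 2\<close>: hence \<open>\<parallel>v\<parallel> \<le> sqrt 2 T(d) \<parallel>C\<parallel> \<parallel>x\<parallel>\<close> (\<open>bidiagonal_solve\<close>, \<open>shift_mat_solve\<close>). On the
  left, \<open>u = B\<^sup>* L\<^sup>* y\<close> satisfies \<open>u\<^sup>* W = y\<^sup>* L\<close>, because \<open>C V + B W = I\<close> and \<open>y\<^sup>* L C = 0\<close>. Therefore
  \<open>u\<^sup>* W G = 0\<close>, and \<open>\<parallel>u\<parallel> \<le> \<parallel>B\<parallel> \<parallel>\<Lambda>\<parallel> \<parallel>y\<parallel>\<close>, where \<open>\<Lambda>\<close> is the vector of moduli of the scalars in \<open>L\<close>.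
  For orthonormal rows \<open>\<parallel>u\<parallel> = \<parallel>W\<^sup>* u\<parallel>\<close>, so the factor \<open>\<parallel>B\<parallel>\<close> disappears, and the weight is at most
  \<open>1\<close>.

  Differentiating \<open>L G = 0\<close> shows that for this choice of \<open>u\<close> and \<open>v\<close> the denominator of the
  condition number of the pencil equals that of \<open>A\<close> (\<open>cscalar_shift_mat_derivative\<close>), which leaves
  exactly the claimed bounds.

  The condition number is a definite description, so it must also be shown to exist and to be
  unique. The determinants of the pencil and of \<open>A\<close> agree up to a nonzero constant
  (\<open>det_linearization\<close>), so the eigenvalue is a simple one of the pencil. For a simple
  eigenvalue the denominator does not vanish, since otherwise the determinant would have a double
  linear factor (\<open>pencil_denominator_nonzero\<close>); and this already forces eigenvectors to be unique up
  to scaling (\<open>eigenvalue_cond_eq\<close>).\<close>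

unbundle no inner_syntax and no vec_syntax

section \<open>Euclidean norms, spectral norms and adjoints\<close>

lemma vec_norm2_L2: "vec_norm2 v = L2_set (\<lambda>i. cmod (v $ i)) {..<dim_vec v}"
  unfolding vec_norm2_def L2_set_def by simp

lemma vec_norm2_nonneg: "0 \<le> vec_norm2 v"
  unfolding vec_norm2_L2 by (rule L2_set_nonneg)

lemma vec_norm2_eq_0_iff: "vec_norm2 v = 0 \<longleftrightarrow> v = 0\<^sub>v (dim_vec v)"
  unfolding vec_norm2_L2 by (auto simp: L2_set_eq_0_iff vec_eq_iff)

lemma vec_norm2_square: "(vec_norm2 v)\<^sup>2 = (\<Sum>i<dim_vec v. (cmod (v $ i))\<^sup>2)"
  unfolding vec_norm2_def by (simp add: sum_nonneg)

lemma cscalar_self: "v \<bullet>c v = complex_of_real ((vec_norm2 v)\<^sup>2)"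
  unfolding vec_norm2_square scalar_prod_def
  by (simp add: lessThan_atLeast0 complex_norm_square[symmetric] del: of_real_power)

lemma vec_norm2_smult: "vec_norm2 (c \<cdot>\<^sub>v v) = cmod c * vec_norm2 v"
  unfolding vec_norm2_L2 by (auto simp: L2_set_right_distrib norm_mult intro!: L2_set_cong)

lemma vec_norm2_conjugate: "vec_norm2 (conjugate v) = vec_norm2 v"
  unfolding vec_norm2_def by simp

lemma scalar_prod_norm_le:
  assumes "dim_vec v = dim_vec w"
  shows "cmod (v \<bullet> w) \<le> vec_norm2 v * vec_norm2 w"
proof -
  have "cmod (v \<bullet> w) \<le> (\<Sum>i<dim_vec w. \<bar>cmod (v $ i)\<bar> * \<bar>cmod (w $ i)\<bar>)"
    unfolding scalar_prod_def lessThan_atLeast0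
    by (rule order_trans[OF norm_sum]) (simp add: norm_mult)
  also have "\<dots> \<le> vec_norm2 v * vec_norm2 w"
    unfolding vec_norm2_L2 assms by (rule L2_set_mult_ineq)
  finally show ?thesis .
qed

lemma cauchy_schwarz_cscalar:
  assumes "dim_vec v = dim_vec w"
  shows "cmod (v \<bullet>c w) \<le> vec_norm2 v * vec_norm2 w"
  using scalar_prod_norm_le[of v "conjugate w"] assms by (simp add: vec_norm2_conjugate)

lemma spectral_norm_set_bdd:
  "bdd_above {vec_norm2 (M *\<^sub>v v) |v. v \<in> carrier_vec (dim_col M) \<and> vec_norm2 v \<le> 1}"
proof (rule bdd_aboveI, clarify)
  fix v assume v: "v \<in> carrier_vec (dim_col M)" "vec_norm2 v \<le> 1"
  have "vec_norm2 (M *\<^sub>v v) \<le> (\<Sum>i<dim_row M. cmod ((M *\<^sub>v v) $ i))"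
    unfolding vec_norm2_L2 by (rule order_trans[OF L2_set_le_sum]) auto
  also have "\<dots> \<le> (\<Sum>i<dim_row M. vec_norm2 (row M i))"
  proof (rule sum_mono)
    fix i assume "i \<in> {..<dim_row M}"
    then have "cmod ((M *\<^sub>v v) $ i) \<le> vec_norm2 (row M i) * vec_norm2 v"
      using v(1) scalar_prod_norm_le[of "row M i" v] by simp
    also have "\<dots> \<le> vec_norm2 (row M i) * 1"
      using v(2) by (rule mult_left_mono) (rule vec_norm2_nonneg)
    finally show "cmod ((M *\<^sub>v v) $ i) \<le> vec_norm2 (row M i)" by simp
  qed
  finally show "vec_norm2 (M *\<^sub>v v) \<le> (\<Sum>i<dim_row M. vec_norm2 (row M i))" .
qed

lemma spectral_norm_nonneg: "0 \<le> spectral_norm M"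
proof -
  have "vec_norm2 (M *\<^sub>v 0\<^sub>v (dim_col M)) \<le> spectral_norm M"
    unfolding spectral_norm_def
    by (rule cSup_upper[OF _ spectral_norm_set_bdd])
       (auto simp: vec_norm2_def intro!: exI[of _ "0\<^sub>v (dim_col M)"])
  then show ?thesis using vec_norm2_nonneg[of "M *\<^sub>v 0\<^sub>v (dim_col M)"] by linarith
qed

lemma spectral_norm_bound:
  assumes v: "v \<in> carrier_vec (dim_col M)"
  shows "vec_norm2 (M *\<^sub>v v) \<le> spectral_norm M * vec_norm2 v"
proof (cases "vec_norm2 v = 0")
  case True
  then have "v = 0\<^sub>v (dim_col M)" using v by (simp add: vec_norm2_eq_0_iff)
  then have "M *\<^sub>v v = 0\<^sub>v (dim_row M)" by (auto intro!: eq_vecI)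
  then show ?thesis using True by (simp add: vec_norm2_def)
next
  case False
  define c where "c = complex_of_real (1 / vec_norm2 v)"
  have pos: "vec_norm2 v > 0" using False vec_norm2_nonneg[of v] by linarith
  then have c: "cmod c = 1 / vec_norm2 v" by (simp add: c_def norm_divide)
  have "vec_norm2 (M *\<^sub>v (c \<cdot>\<^sub>v v)) \<le> spectral_norm M"
    unfolding spectral_norm_def using v pos
    by (intro cSup_upper[OF _ spectral_norm_set_bdd])
       (auto simp: vec_norm2_smult c intro!: exI[of _ "c \<cdot>\<^sub>v v"])
  also have "M *\<^sub>v (c \<cdot>\<^sub>v v) = c \<cdot>\<^sub>v (M *\<^sub>v v)"
    using v by (intro mult_mat_vec) auto
  finally show ?thesis using pos by (simp add: vec_norm2_smult c field_simps)
qed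

lemma spectral_norm_le:
  assumes "\<And>v. v \<in> carrier_vec (dim_col M) \<Longrightarrow> vec_norm2 (M *\<^sub>v v) \<le> C * vec_norm2 v"
    and "0 \<le> C"
  shows "spectral_norm M \<le> C"
  unfolding spectral_norm_def
proof (rule cSup_least)
  show "{vec_norm2 (M *\<^sub>v v) |v. v \<in> carrier_vec (dim_col M) \<and> vec_norm2 v \<le> 1} \<noteq> {}"
    by (auto intro!: exI[of _ "0\<^sub>v (dim_col M)"] simp: vec_norm2_def)
next
  fix r assume "r \<in> {vec_norm2 (M *\<^sub>v v) |v. v \<in> carrier_vec (dim_col M) \<and> vec_norm2 v \<le> 1}"
  then obtain v where v: "v \<in> carrier_vec (dim_col M)" "vec_norm2 v \<le> 1"
    and r: "r = vec_norm2 (M *\<^sub>v v)" by auto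
  have "r \<le> C * vec_norm2 v" unfolding r by (rule assms(1)[OF v(1)])
  also have "\<dots> \<le> C * 1" using v(2) assms(2) by (rule mult_left_mono)
  finally show "r \<le> C" by simp
qed

lemma le_of_square_le_mult:
  fixes a b :: real
  assumes "a * a \<le> a * b" "0 \<le> b"
  shows "a \<le> b"
proof (cases "a \<le> 0")
  case False
  then show ?thesis using assms(1) by (simp add: mult_le_cancel_left_pos)
qed (use assms(2) in linarith)

text \<open>The vector \<open>M\<^sup>* w\<close>. A left eigenvector of \<open>M\<close> is a vector \<open>y\<close> with \<open>M\<^sup>* y = 0\<close>, so
  with this notation both kinds of eigenvectors are column vectors.\<close>

definition adj_mult_vec :: "complex mat \<Rightarrow> complex vec \<Rightarrow> complex vec" where
  "adj_mult_vec M w = conjugate (M\<^sup>T *\<^sub>v conjugate w)"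

lemma adj_mult_vec_carrier[simp]: "adj_mult_vec M w \<in> carrier_vec (dim_col M)"
  unfolding adj_mult_vec_def by (rule carrier_vecI) simp

lemma dim_adj_mult_vec[simp]: "dim_vec (adj_mult_vec M w) = dim_col M"
  unfolding adj_mult_vec_def by simp

lemma cscalar_adj:
  assumes M: "M \<in> carrier_mat r c" and v: "v \<in> carrier_vec c" and w: "w \<in> carrier_vec r"
  shows "(M *\<^sub>v v) \<bullet>c w = v \<bullet>c adj_mult_vec M w"
proof -
  have w': "conjugate w \<in> carrier_vec r" using w by simp
  have "(M *\<^sub>v v) \<bullet>c w = conjugate w \<bullet> (M *\<^sub>v v)"
    using M v w' by (intro comm_scalar_prod[of _ r]) auto
  also have "\<dots> = (M\<^sup>T *\<^sub>v conjugate w) \<bullet> v"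
    using transpose_vec_mult_scalar[OF M v w'] by simp
  also have "\<dots> = v \<bullet> (M\<^sup>T *\<^sub>v conjugate w)"
    using M v w' by (intro comm_scalar_prod[of _ c]) auto
  finally show ?thesis by (simp add: adj_mult_vec_def)
qed

lemma cscalar_zero_imp_zero:
  fixes u :: "complex vec"
  assumes u: "u \<in> carrier_vec c" and "\<And>v. v \<in> carrier_vec c \<Longrightarrow> v \<bullet>c u = 0"
  shows "u = 0\<^sub>v c"
proof -
  have "vec_norm2 u = 0" using assms(2)[OF u] by (simp add: cscalar_self del: of_real_power)
  then show ?thesis using u by (simp add: vec_norm2_eq_0_iff)
qed

text \<open>An adjoint image is identified by testing it against all vectors; below this replaces
  computations with the entries of \<open>M\<^sup>*\<close>.\<close>

lemma adj_mult_vec_eqI: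
  assumes "M \<in> carrier_mat r c" "w \<in> carrier_vec r" "u \<in> carrier_vec c"
    and "\<And>v. v \<in> carrier_vec c \<Longrightarrow> (M *\<^sub>v v) \<bullet>c w = v \<bullet>c u"
  shows "adj_mult_vec M w = u"
proof -
  have c: "adj_mult_vec M w \<in> carrier_vec c"
    using assms(1) adj_mult_vec_carrier[of M w] by simp
  have "adj_mult_vec M w - u = 0\<^sub>v c"
  proof (rule cscalar_zero_imp_zero)
    show "adj_mult_vec M w - u \<in> carrier_vec c" using c assms(3) by simp
    fix v :: "complex vec" assume v: "v \<in> carrier_vec c"
    have "conjugate (a - b) = conjugate a - conjugate b" if "dim_vec a = dim_vec b"
      for a b :: "complex vec" using that by (intro eq_vecI) simp_all
    then have "v \<bullet>c (adj_mult_vec M w - u) = v \<bullet> (conjugate (adj_mult_vec M w) - conjugate u)"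
      using c assms(3) by (metis carrier_vecD)
    also have "\<dots> = v \<bullet>c adj_mult_vec M w - v \<bullet>c u"
      using v c assms(3) by (intro scalar_prod_minus_distrib) auto
    also have "\<dots> = 0"
      using assms(4)[OF v] cscalar_adj[OF assms(1) v assms(2)] by simp
    finally show "v \<bullet>c (adj_mult_vec M w - u) = 0" .
  qed
  then have "(adj_mult_vec M w - u) $ i = 0" if "i < c" for i using that by simp
  then show ?thesis using c assms(1,3) by (intro eq_vecI) auto
qed

text \<open>This is \<open>\<parallel>M\<^sup>*\<parallel> \<le> \<parallel>M\<parallel>\<close>: for \<open>u = M\<^sup>* w\<close>, Cauchy--Schwarz applied to
  \<open>\<parallel>u\<parallel>\<^sup>2 = w\<^sup>* M u\<close> leaves one factor \<open>\<parallel>u\<parallel>\<close> to cancel.\<close>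

lemma adj_mult_vec_norm_le:
  assumes w: "w \<in> carrier_vec (dim_row M)"
  shows "vec_norm2 (adj_mult_vec M w) \<le> spectral_norm M * vec_norm2 w"
proof -
  let ?u = "adj_mult_vec M w"
  have "(vec_norm2 ?u)\<^sup>2 = cmod (?u \<bullet>c ?u)"
    by (simp add: cscalar_self norm_power vec_norm2_nonneg)
  also have "?u \<bullet>c ?u = (M *\<^sub>v ?u) \<bullet>c w"
    by (rule cscalar_adj[symmetric, of _ "dim_row M" "dim_col M"]) (use w in auto)
  also have "cmod \<dots> \<le> vec_norm2 (M *\<^sub>v ?u) * vec_norm2 w"
    using w by (intro cauchy_schwarz_cscalar) auto
  also have "\<dots> \<le> (spectral_norm M * vec_norm2 ?u) * vec_norm2 w"
    by (intro mult_right_mono spectral_norm_bound vec_norm2_nonneg) simp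
  finally have *: "vec_norm2 ?u * vec_norm2 ?u \<le> vec_norm2 ?u * (spectral_norm M * vec_norm2 w)"
    by (simp add: power2_eq_square mult_ac)
  show ?thesis
    by (rule le_of_square_le_mult[OF *]) (simp add: spectral_norm_nonneg vec_norm2_nonneg)
qed

lemma left_eigenvector_iff:
  "left_eigenvector M y \<longleftrightarrow>
     y \<in> carrier_vec (dim_row M) \<and> y \<noteq> 0\<^sub>v (dim_row M) \<and> adj_mult_vec M y = 0\<^sub>v (dim_col M)"
proof -
  have "mat_of_row (conjugate y) * M = 0\<^sub>m 1 (dim_col M) \<longleftrightarrow>
      adj_mult_vec M y = 0\<^sub>v (dim_col M)" if y: "y \<in> carrier_vec (dim_row M)"
  proof -
    have e: "(mat_of_row (conjugate y) * M) $$ (0, j) = conjugate (adj_mult_vec M y $ j)"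
      if "j < dim_col M" for j
    proof -
      have "(mat_of_row (conjugate y) * M) $$ (0, j) = conjugate y \<bullet> col M j"
        using that by simp
      also have "\<dots> = col M j \<bullet> conjugate y"
        using that y by (intro comm_scalar_prod[of _ "dim_row M"]) auto
      finally show ?thesis using that by (simp add: adj_mult_vec_def)
    qed
    have "mat_of_row (conjugate y) * M = 0\<^sub>m 1 (dim_col M) \<longleftrightarrow>
        (\<forall>j<dim_col M. (mat_of_row (conjugate y) * M) $$ (0, j) = 0)"
      by (auto simp: mat_eq_iff)
    also have "\<dots> \<longleftrightarrow> (\<forall>j<dim_col M. adj_mult_vec M y $ j = 0)"
      by (simp add: e del: index_mult_mat)
    also have "\<dots> \<longleftrightarrow> adj_mult_vec M y = 0\<^sub>v (dim_col M)"
      by (auto simp: vec_eq_iff)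
    finally show ?thesis .
  qed
  then show ?thesis unfolding left_eigenvector_def by blast
qed

lemma orthonormal_rows_adj:
  assumes W: "orthonormal_rows W" and y: "y \<in> carrier_vec (dim_row W)"
  shows "W *\<^sub>v adj_mult_vec W y = y"
proof (rule eq_vecI)
  fix i assume "i < dim_vec y"
  then have i: "i < dim_row W" using y by simp
  have "(W *\<^sub>v adj_mult_vec W y) $ i
      = (\<Sum>c<dim_col W. W $$ (i, c) * (\<Sum>j<dim_row W. cnj (W $$ (j, c)) * y $ j))"
    using i y by (auto simp: adj_mult_vec_def scalar_prod_def lessThan_atLeast0 intro!: sum.cong)
  also have "\<dots> = (\<Sum>j<dim_row W. (\<Sum>c<dim_col W. W $$ (i, c) * cnj (W $$ (j, c))) * y $ j)"
    unfolding sum_distrib_left sum_distrib_right mult.assoc by (rule sum.swap)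
  also have "\<dots> = (\<Sum>j<dim_row W. (row W i \<bullet>c row W j) * y $ j)"
    using i by (intro sum.cong) (auto simp: scalar_prod_def lessThan_atLeast0)
  also have "\<dots> = (\<Sum>j<dim_row W. (if i = j then y $ j else 0))"
    using W i unfolding orthonormal_rows_def by (intro sum.cong) auto
  finally show "(W *\<^sub>v adj_mult_vec W y) $ i = y $ i" using i by simp
qed (use y in auto)

lemma orthonormal_rows_adj_norm:
  assumes W: "orthonormal_rows W" and y: "y \<in> carrier_vec (dim_row W)"
  shows "vec_norm2 (adj_mult_vec W y) = vec_norm2 y"
proof -
  have "complex_of_real ((vec_norm2 (adj_mult_vec W y))\<^sup>2) = (W *\<^sub>v adj_mult_vec W y) \<bullet>c y"
    unfolding cscalar_self[symmetric]
    by (rule cscalar_adj[symmetric, of _ "dim_row W" "dim_col W"]) (use y in auto)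
  then have "(vec_norm2 (adj_mult_vec W y))\<^sup>2 = (vec_norm2 y)\<^sup>2"
    unfolding orthonormal_rows_adj[OF W y] cscalar_self of_real_eq_iff .
  then show ?thesis using vec_norm2_nonneg by (simp add: power2_eq_iff_nonneg)
qed

text \<open>Orthonormality of the rows makes \<open>W\<^sup>*\<close> an isometry, and the norm of \<open>W\<close> is that of \<open>W\<^sup>*\<close>.\<close>

lemma orthonormal_rows_norm_le:
  assumes W: "orthonormal_rows W" and v: "v \<in> carrier_vec (dim_col W)"
  shows "vec_norm2 (W *\<^sub>v v) \<le> vec_norm2 v"
proof -
  let ?p = "W *\<^sub>v v"
  have p: "?p \<in> carrier_vec (dim_row W)" by (rule carrier_vecI) simp
  have "(vec_norm2 ?p)\<^sup>2 = cmod (?p \<bullet>c ?p)"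
    by (simp add: cscalar_self norm_power vec_norm2_nonneg)
  also have "?p \<bullet>c ?p = v \<bullet>c adj_mult_vec W ?p"
    by (rule cscalar_adj[of _ "dim_row W" "dim_col W"]) (use v p in auto)
  also have "cmod \<dots> \<le> vec_norm2 v * vec_norm2 (adj_mult_vec W ?p)"
    using v by (intro cauchy_schwarz_cscalar) auto
  finally have *: "vec_norm2 ?p * vec_norm2 ?p \<le> vec_norm2 ?p * vec_norm2 v"
    unfolding orthonormal_rows_adj_norm[OF W p] by (simp add: power2_eq_square mult_ac)
  show ?thesis by (rule le_of_square_le_mult[OF *]) (rule vec_norm2_nonneg)
qed

section \<open>Double factors of determinants\<close>

lemma dvd_det_of_dvd_row:
  fixes M :: "'a :: comm_ring_1 mat"
  assumes M: "M \<in> carrier_mat n n" and i: "i < n" and "\<And>j. j < n \<Longrightarrow> l dvd M $$ (i, j)"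
  shows "l dvd det M"
  unfolding laplace_expansion_row[OF M i] using assms(3) by (auto intro!: dvd_sum)

text \<open>In the expansion along column \<open>j\<close> every entry is divisible by \<open>l\<close>, and each cofactor that
  meets a nonzero entry still contains row \<open>i\<close>, which contributes the second factor \<open>l\<close>.\<close>

lemma square_dvd_det:
  fixes M :: "'a :: comm_ring_1 mat"
  assumes M: "M \<in> carrier_mat n n" and i: "i < n" and j: "j < n"
    and row: "\<And>c. c < n \<Longrightarrow> c \<noteq> j \<Longrightarrow> l dvd M $$ (i, c)"
    and col: "\<And>r. r < n \<Longrightarrow> r \<noteq> i \<Longrightarrow> l dvd M $$ (r, j)"
    and 0: "M $$ (i, j) = 0"
  shows "l ^ 2 dvd det M"
  unfolding laplace_expansion_column[OF M j]
proof (rule dvd_sum)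
  fix r assume r: "r \<in> {..<n}"
  show "l\<^sup>2 dvd M $$ (r, j) * cofactor M r j"
  proof (cases "r = i")
    case True
    then show ?thesis by (simp add: 0)
  next
    case False
    have "l dvd det (mat_delete M r j)"
    proof (rule dvd_det_of_dvd_row)
      show "mat_delete M r j \<in> carrier_mat (n - 1) (n - 1)"
        using M by (simp add: mat_delete_def)
      \<comment> \<open>The index of row \<open>i\<close> after row \<open>r\<close> has been deleted.\<close>
      define i' where "i' = (if i < r then i else i - 1)"
      show i': "i' < n - 1" using i r False by (auto simp: i'_def)
      fix c assume c: "c < n - 1"
      have "mat_delete M r j $$ (i', c) = M $$ (i, if c < j then c else Suc c)"
        using M i' c i r False by (auto simp: mat_delete_def i'_def)
      moreover have "l dvd M $$ (i, if c < j then c else Suc c)"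
        using c by (intro row) auto
      ultimately show "l dvd mat_delete M r j $$ (i', c)" by simp
    qed
    then have "l dvd cofactor M r j" by (simp add: cofactor_def)
    moreover have "l dvd M $$ (r, j)" using r False by (intro col) auto
    ultimately show ?thesis unfolding power2_eq_square by (intro mult_dvd_mono)
  qed
qed

text \<open>Cramer's trick brings an arbitrary matrix into the shape required by the previous lemma, at
  the price of one coordinate of \<open>x\<close> and one of \<open>y\<close>: first column \<open>j\<close> is replaced by \<open>M x\<close>, then a row by the combination of all rows with the coefficients of \<open>y\<close>. The entry where they cross becomes \<open>y\<^sup>T M x\<close>.\<close>

lemma square_dvd_det_bordered:
  fixes M :: "'a :: idom mat"
  assumes M: "M \<in> carrier_mat n n" and x: "x \<in> carrier_vec n" and y: "y \<in> carrier_vec n"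
    and i: "i < n" and j: "j < n"
    and col: "\<And>r. r < n \<Longrightarrow> l dvd (M *\<^sub>v x) $ r"
    and row: "\<And>c. c < n \<Longrightarrow> l dvd (M\<^sup>T *\<^sub>v y) $ c"
    and 0: "y \<bullet> (M *\<^sub>v x) = 0"
  shows "l ^ 2 dvd y $ i * x $ j * det M"
proof -
  \<comment> \<open>\<open>M1\<close> has \<open>M x\<close> as column \<open>j\<close>; the row operation is carried out as a column operation on its transpose.\<close>
  define M1 where "M1 = replace_col M (M *\<^sub>v x) j"
  have M1: "M1 \<in> carrier_mat n n" using M by (simp add: M1_def replace_col_def)
  have M1T: "M1\<^sup>T \<in> carrier_mat n n" using M1 by simp
  define M2 where "M2 = replace_col M1\<^sup>T (M1\<^sup>T *\<^sub>v y) i"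
  have M2: "M2 \<in> carrier_mat n n" using M1 by (simp add: M2_def replace_col_def)
  have M1_entry: "M1 $$ (r, c) = (if c = j then (M *\<^sub>v x) $ r else M $$ (r, c))"
    if "r < n" "c < n" for r c using that M by (simp add: M1_def replace_col_def)
  have M1y: "(M1\<^sup>T *\<^sub>v y) $ c = (if c = j then 0 else (M\<^sup>T *\<^sub>v y) $ c)" if c: "c < n" for c
  proof (cases "c = j")
    case True
    have "(M1\<^sup>T *\<^sub>v y) $ c = col M1 j \<bullet> y" using M1 True j by simp
    also have "col M1 j = M *\<^sub>v x" using M M1 j by (intro eq_vecI) (auto simp: M1_entry)
    also have "(M *\<^sub>v x) \<bullet> y = 0" using 0 M x y comm_scalar_prod[of y n "M *\<^sub>v x"] by auto
    finally show ?thesis using True by simp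
  next
    case False
    have "col M1 c = col M c" using M M1 c False by (intro eq_vecI) (auto simp: M1_entry)
    then show ?thesis using M M1 c False by simp
  qed
  have "l ^ 2 dvd det M2"
  proof (rule square_dvd_det[OF M2 j i])
    fix c assume "c < n" "c \<noteq> i"
    then show "l dvd M2 $$ (j, c)" using M1 j by (simp add: M2_def replace_col_def M1_entry col)
  next
    fix r assume "r < n" "r \<noteq> j"
    then show "l dvd M2 $$ (r, i)" using M1 i M1y[of r] row[of r] by (simp add: M2_def replace_col_def)
  next
    show "M2 $$ (j, i) = 0" using M1 i j M1y[of j] by (simp add: M2_def replace_col_def)
  qed
  also have "det M2 = y $ i * det M1\<^sup>T"
    unfolding M2_def by (rule cramer_lemma_mat[OF M1T y i])
  also have "det M1\<^sup>T = det M1" using M1 by (rule det_transpose)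
  also have "det M1 = x $ j * det M"
    unfolding M1_def by (rule cramer_lemma_mat[OF M x j])
  finally show ?thesis by (simp add: mult_ac)
qed

section \<open>The condition number of a simple eigenvalue of a pencil\<close>

lemma const2_sum: "[:[:sum f S:]:] = (\<Sum>i\<in>S. [:[:f i:]:])" for f :: "'b \<Rightarrow> 'a :: comm_ring_1"
proof (induction S rule: infinite_finite_induct)
  case (insert i S)
  have "[:[:f i + sum f S:]:] = [:[:f i:]:] + [:[:sum f S:]:]" by simp
  then show ?case using insert by simp
qed simp_all

lemma const2_scalar_prod:
  fixes u v :: "'a :: comm_ring_1 vec"
  assumes "dim_vec u = dim_vec v"
  shows "map_vec (\<lambda>c. [:[:c:]:]) u \<bullet> map_vec (\<lambda>c. [:[:c:]:]) v = [:[:u \<bullet> v:]:]"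
  using assms by (simp add: scalar_prod_def const2_sum)

lemma bilin_sum:
  assumes "M \<in> carrier_mat N N" "x \<in> carrier_vec N" "y \<in> carrier_vec N"
  shows "bilin y M x = (\<Sum>r<N. (M *\<^sub>v x) $ r * cnj (y $ r))"
  using assms by (simp add: bilin_def scalar_prod_def lessThan_atLeast0)

lemma bilin_conv_transpose:
  assumes "M \<in> carrier_mat N N" "x \<in> carrier_vec N" "y \<in> carrier_vec N"
  shows "bilin y M x = conjugate y \<bullet> (M *\<^sub>v x)"
  unfolding bilin_def using assms by (intro comm_scalar_prod[of _ N]) auto

lemma bilin_diff_right:
  assumes "M \<in> carrier_mat N N" "x \<in> carrier_vec N" "x' \<in> carrier_vec N" "y \<in> carrier_vec N"
  shows "bilin y M (a \<cdot>\<^sub>v x' - b \<cdot>\<^sub>v x) = a * bilin y M x' - b * bilin y M x"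
proof -
  have "M *\<^sub>v (a \<cdot>\<^sub>v x' - b \<cdot>\<^sub>v x) = a \<cdot>\<^sub>v (M *\<^sub>v x') - b \<cdot>\<^sub>v (M *\<^sub>v x)"
    using assms by (simp add: mult_minus_distrib_mat_vec mult_mat_vec)
  then show ?thesis
    using assms by (simp add: bilin_sum[of M N] left_diff_distrib sum_subtractf sum_distrib_left mult.assoc)
qed

lemma bilin_diff_left:
  assumes "M \<in> carrier_mat N N" "x \<in> carrier_vec N" "y \<in> carrier_vec N" "y' \<in> carrier_vec N"
  shows "bilin (a \<cdot>\<^sub>v y' - b \<cdot>\<^sub>v y) M x = cnj a * bilin y' M x - cnj b * bilin y M x"
  using assms by (simp add: bilin_sum[of M N] right_diff_distrib sum_subtractf sum_distrib_left mult_ac)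

lemma bilin_smult:
  assumes "M \<in> carrier_mat N N" "x \<in> carrier_vec N" "y \<in> carrier_vec N"
  shows "bilin (b \<cdot>\<^sub>v y) M (a \<cdot>\<^sub>v x) = cnj b * a * bilin y M x"
  using assms by (simp add: bilin_sum[of M N] mult_mat_vec sum_distrib_left mult_ac)

lemma adj_mult_vec_diff:
  assumes "M \<in> carrier_mat N N" "y \<in> carrier_vec N" "y' \<in> carrier_vec N"
  shows "adj_mult_vec M (a \<cdot>\<^sub>v y' - b \<cdot>\<^sub>v y) = a \<cdot>\<^sub>v adj_mult_vec M y' - b \<cdot>\<^sub>v adj_mult_vec M y"
  using assms
  by (intro eq_vecI) (auto simp: adj_mult_vec_def scalar_prod_def right_diff_distrib sum_subtractf
      sum_distrib_left mult_ac)

text \<open>Let \<open>s\<close> and \<open>t\<close> be the two variables. In the unitary coordinates \<open>l = \<mu> s - \<lambda> t\<close> and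
  \<open>m = cnj \<lambda> s + cnj \<mu> t\<close> the pencil \<open>t W0 - s W1\<close> reads \<open>m M0 - l M1\<close>, where \<open>M0\<close> is its value at
  \<open>(\<lambda>, \<mu>)\<close> and \<open>M1 = cnj \<mu> W1 + cnj \<lambda> W0\<close> is the matrix in the denominator of the condition
  number. As \<open>M0 x = 0\<close> and \<open>y\<^sup>* M0 = 0\<close>, applying the pencil to \<open>x\<close> or to \<open>y\<^sup>*\<close> leaves multiples of
  \<open>l\<close>. If also \<open>y\<^sup>* M1 x = 0\<close>, the bordered determinant has a double factor \<open>l\<close>, and the root is
  not simple.\<close>

lemma pencil_denominator_nonzero:
  assumes W0: "W0 \<in> carrier_mat N N" and W1: "W1 \<in> carrier_mat N N"
    and nrm: "(cmod lam)\<^sup>2 + (cmod mu)\<^sup>2 = 1"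
    and simple: "simple_eigenvalue N 1 (pencil_coeffs W0 W1) lam mu"
    and x: "right_eigenvector (mu \<cdot>\<^sub>m W0 - lam \<cdot>\<^sub>m W1) x"
    and y: "left_eigenvector (mu \<cdot>\<^sub>m W0 - lam \<cdot>\<^sub>m W1) y"
  shows "bilin y (cnj mu \<cdot>\<^sub>m W1 + cnj lam \<cdot>\<^sub>m W0) x \<noteq> 0"
proof
  assume bilin0: "bilin y (cnj mu \<cdot>\<^sub>m W1 + cnj lam \<cdot>\<^sub>m W0) x = 0"
  define M0 where "M0 = mu \<cdot>\<^sub>m W0 - lam \<cdot>\<^sub>m W1"
  define M1 where "M1 = cnj mu \<cdot>\<^sub>m W1 + cnj lam \<cdot>\<^sub>m W0"
  have M0: "M0 \<in> carrier_mat N N" and M1: "M1 \<in> carrier_mat N N"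
    using W0 W1 by (auto simp: M0_def M1_def)
  define l :: "complex poly poly" where "l = [:[:0, - lam:], [:mu:]:]"
  define m :: "complex poly poly" where "m = [:[:0, cnj mu:], [:cnj lam:]:]"
  define P where "P = mat N N (\<lambda>(r, c). \<Sum>i\<le>1. monom (monom (pencil_coeffs W0 W1 i $$ (r, c)) (1 - i)) i)"
  let ?c = "\<lambda>z :: complex. [:[:z:]:]"
  have P: "P \<in> carrier_mat N N" by (simp add: P_def)
  have xN: "x \<in> carrier_vec N" "x \<noteq> 0\<^sub>v N" and M0x: "M0 *\<^sub>v x = 0\<^sub>v N"
    using x M0 unfolding M0_def[symmetric] right_eigenvector_def by auto
  have yN: "y \<in> carrier_vec N" "y \<noteq> 0\<^sub>v N" and M0y: "adj_mult_vec M0 y = 0\<^sub>v N"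
    using y M0 unfolding M0_def[symmetric] left_eigenvector_iff by auto
  have M0Ty: "M0\<^sup>T *\<^sub>v conjugate y = 0\<^sub>v N"
    using M0y unfolding adj_mult_vec_def by (metis conjugate_id conjugate_zero_vec)
  have "lam * cnj lam + mu * cnj mu = of_real ((cmod lam)\<^sup>2 + (cmod mu)\<^sup>2)"
    by (simp add: complex_norm_square[symmetric] del: of_real_power)
  then have unit: "lam * cnj lam + mu * cnj mu = 1" unfolding nrm by simp
  have c0: "w = mu * (w * cnj mu) + lam * (w * cnj lam)" for w
  proof -
    have "w = w * (lam * cnj lam + mu * cnj mu)" unfolding unit by simp
    then show ?thesis by (simp add: algebra_simps)
  qed
  have P_entry: "P $$ (r, c) = m * ?c (M0 $$ (r, c)) - l * ?c (M1 $$ (r, c))"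
    if "r < N" "c < N" for r c
  proof -
    have "P $$ (r, c) = [:[:0, W0 $$ (r, c):], [:- (W1 $$ (r, c)):]:]"
      using that W1 by (simp add: P_def pencil_coeffs_def monom_0 monom_Suc)
    also have "\<dots> = m * ?c (M0 $$ (r, c)) - l * ?c (M1 $$ (r, c))"
      using that W0 W1 c0[of "W0 $$ (r, c)"] c0[of "W1 $$ (r, c)"]
      by (simp add: M0_def M1_def m_def l_def algebra_simps)
    finally show ?thesis .
  qed
  define X where "X = map_vec ?c x"
  define Y where "Y = map_vec ?c (conjugate y)"
  have X: "X \<in> carrier_vec N" and Y: "Y \<in> carrier_vec N" using xN yN by (auto simp: X_def Y_def)
  have PX: "(P *\<^sub>v X) $ r = - l * ?c ((M1 *\<^sub>v x) $ r)" if r: "r < N" for r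
  proof -
    have "(P *\<^sub>v X) $ r = (\<Sum>c<N. (m * ?c (M0 $$ (r, c)) - l * ?c (M1 $$ (r, c))) * ?c (x $ c))"
      using P r xN by (auto simp: scalar_prod_def X_def P_entry lessThan_atLeast0 intro!: sum.cong)
    also have "\<dots> = m * ?c ((M0 *\<^sub>v x) $ r) - l * ?c ((M1 *\<^sub>v x) $ r)"
      using M0 M1 r xN
      by (simp add: scalar_prod_def const2_sum lessThan_atLeast0 sum_distrib_left left_diff_distrib
          sum_subtractf mult_smult_right del: mult_pCons_left mult_pCons_right) simp
    finally show ?thesis using M0x r by simp
  qed
  have PY: "(P\<^sup>T *\<^sub>v Y) $ c = - l * ?c ((M1\<^sup>T *\<^sub>v conjugate y) $ c)" if c: "c < N" for c
  proof -
    have "(P\<^sup>T *\<^sub>v Y) $ c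
        = (\<Sum>r<N. (m * ?c (M0 $$ (r, c)) - l * ?c (M1 $$ (r, c))) * ?c (cnj (y $ r)))"
      using P c yN by (auto simp: scalar_prod_def Y_def P_entry lessThan_atLeast0 intro!: sum.cong)
    also have "\<dots> = m * ?c ((M0\<^sup>T *\<^sub>v conjugate y) $ c) - l * ?c ((M1\<^sup>T *\<^sub>v conjugate y) $ c)"
      using M0 M1 c yN
      by (simp add: scalar_prod_def const2_sum lessThan_atLeast0 sum_distrib_left left_diff_distrib
          sum_subtractf mult_smult_right del: mult_pCons_left mult_pCons_right) simp
    finally show ?thesis using M0Ty c by simp
  qed
  have "P *\<^sub>v X = (- l) \<cdot>\<^sub>v map_vec ?c (M1 *\<^sub>v x)"
    using P M1 PX by (intro eq_vecI) auto
  then have "Y \<bullet> (P *\<^sub>v X) = - l * (map_vec ?c (conjugate y) \<bullet> map_vec ?c (M1 *\<^sub>v x))"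
    using M1 yN by (simp add: Y_def)
  also have "map_vec ?c (conjugate y) \<bullet> map_vec ?c (M1 *\<^sub>v x) = ?c (conjugate y \<bullet> (M1 *\<^sub>v x))"
    using M1 yN by (intro const2_scalar_prod) auto
  also have "conjugate y \<bullet> (M1 *\<^sub>v x) = 0"
    using bilin0 bilin_conv_transpose[OF M1 xN(1) yN(1)] unfolding M1_def by simp
  finally have YPX: "Y \<bullet> (P *\<^sub>v X) = 0" by simp
  from xN obtain j where j: "j < N" "x $ j \<noteq> 0" by (auto simp: vec_eq_iff)
  from yN obtain i where i: "i < N" "y $ i \<noteq> 0" by (auto simp: vec_eq_iff)
  have dvdY: "l ^ 2 dvd Y $ i * X $ j * det P"
  proof (rule square_dvd_det_bordered[OF P X Y i(1) j(1) _ _ YPX])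
    show "l dvd (P *\<^sub>v X) $ r" if "r < N" for r
      unfolding PX[OF that] by (rule dvd_mult2) simp
    show "l dvd (P\<^sup>T *\<^sub>v Y) $ c" if "c < N" for c
      unfolding PY[OF that] by (rule dvd_mult2) simp
  qed
  define t where "t = cnj (y $ i) * x $ j"
  have t: "t \<noteq> 0" using i j by (simp add: t_def)
  have "?c (inverse t) * ?c t = 1" using t by (simp add: one_pCons)
  then have "det P = ?c (inverse t) * (?c t * det P)" by (metis mult.assoc mult_1)
  also have "?c t = Y $ i * X $ j"
    using i j xN yN by (simp add: X_def Y_def t_def)
  finally have "l ^ 2 dvd det P" using dvdY by (metis dvd_mult)
  then have "l ^ 2 dvd mpoly_det N 1 (pencil_coeffs W0 W1)" by (simp add: mpoly_det_def P_def)
  then show False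
    using simple unfolding simple_eigenvalue_def simple_hom_root_def l_def by (simp add: Let_def)
qed

text \<open>The value does not depend on the eigenvectors because each of them is unique up to scaling.
  This in turn follows from the nonvanishing of the denominator: a suitable combination of two
  right eigenvectors \<open>x\<close> and \<open>u\<close> makes it vanish, so that combination cannot be an eigenvector
  and must be the zero vector.\<close>

lemma eigenvalue_cond_eq:
  assumes W0: "W0 \<in> carrier_mat N N" and W1: "W1 \<in> carrier_mat N N"
    and nrm: "(cmod lam)\<^sup>2 + (cmod mu)\<^sup>2 = 1"
    and simple: "simple_eigenvalue N 1 (pencil_coeffs W0 W1) lam mu"
    and x: "right_eigenvector (mu \<cdot>\<^sub>m W0 - lam \<cdot>\<^sub>m W1) x"
    and y: "left_eigenvector (mu \<cdot>\<^sub>m W0 - lam \<cdot>\<^sub>m W1) y"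
  shows "eigenvalue_cond W0 W1 lam mu = pencil_weight W0 W1 lam mu *
     (vec_norm2 x * vec_norm2 y / cmod (bilin y (cnj mu \<cdot>\<^sub>m W1 + cnj lam \<cdot>\<^sub>m W0) x))"
proof -
  define M0 where "M0 = mu \<cdot>\<^sub>m W0 - lam \<cdot>\<^sub>m W1"
  define M1 where "M1 = cnj mu \<cdot>\<^sub>m W1 + cnj lam \<cdot>\<^sub>m W0"
  have M0: "M0 \<in> carrier_mat N N" and M1: "M1 \<in> carrier_mat N N"
    using W0 W1 by (auto simp: M0_def M1_def)
  have R: "right_eigenvector M0 u \<longleftrightarrow> u \<in> carrier_vec N \<and> u \<noteq> 0\<^sub>v N \<and> M0 *\<^sub>v u = 0\<^sub>v N" for u
    using M0 by (auto simp: right_eigenvector_def)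
  have L: "left_eigenvector M0 u \<longleftrightarrow> u \<in> carrier_vec N \<and> u \<noteq> 0\<^sub>v N \<and> adj_mult_vec M0 u = 0\<^sub>v N" for u
    using M0 by (auto simp: left_eigenvector_iff)
  have nz: "bilin v M1 u \<noteq> 0" if "right_eigenvector M0 u" "left_eigenvector M0 v" for u v
    using pencil_denominator_nonzero[OF W0 W1 nrm simple] that by (simp add: M0_def M1_def)
  note x = x[folded M0_def] and y = y[folded M0_def]
  have xN: "x \<in> carrier_vec N" and yN: "y \<in> carrier_vec N" using x y by (auto simp: R L)
  have unique: "vec_norm2 u * vec_norm2 v / cmod (bilin v M1 u)
      = vec_norm2 x * vec_norm2 y / cmod (bilin y M1 x)"
    if u: "right_eigenvector M0 u" and v: "left_eigenvector M0 v" for u v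
  proof -
    have uN: "u \<in> carrier_vec N" and vN: "v \<in> carrier_vec N" using u v by (auto simp: R L)
    \<comment> \<open>The factors for which \<open>u - a x\<close> and \<open>v - b y\<close> annihilate the denominator.\<close>
    define a where "a = bilin y M1 u / bilin y M1 x"
    define b where "b = cnj (bilin v M1 x / bilin y M1 x)"
    have nxy: "bilin y M1 x \<noteq> 0" by (rule nz[OF x y])
    have "1 \<cdot>\<^sub>v u - a \<cdot>\<^sub>v x = 0\<^sub>v N"
    proof (rule ccontr)
      assume ne: "1 \<cdot>\<^sub>v u - a \<cdot>\<^sub>v x \<noteq> 0\<^sub>v N"
      have "M0 *\<^sub>v (1 \<cdot>\<^sub>v u - a \<cdot>\<^sub>v x) = 0\<^sub>v N"
        using M0 uN xN u x by (intro eq_vecI) (auto simp: R mult_minus_distrib_mat_vec mult_mat_vec)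
      with ne have "right_eigenvector M0 (1 \<cdot>\<^sub>v u - a \<cdot>\<^sub>v x)" using uN xN by (simp add: R)
      then have "bilin y M1 (1 \<cdot>\<^sub>v u - a \<cdot>\<^sub>v x) \<noteq> 0" using y by (rule nz)
      moreover have "bilin y M1 (1 \<cdot>\<^sub>v u - a \<cdot>\<^sub>v x) = 0"
        unfolding bilin_diff_right[OF M1 xN uN yN] using nxy by (simp add: a_def)
      ultimately show False by simp
    qed
    then have "(1 \<cdot>\<^sub>v u - a \<cdot>\<^sub>v x) $ r = 0" if "r < N" for r using that by simp
    then have ux: "u = a \<cdot>\<^sub>v x" using uN xN by (intro eq_vecI) auto
    have "1 \<cdot>\<^sub>v v - b \<cdot>\<^sub>v y = 0\<^sub>v N"
    proof (rule ccontr)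
      assume ne: "1 \<cdot>\<^sub>v v - b \<cdot>\<^sub>v y \<noteq> 0\<^sub>v N"
      have "adj_mult_vec M0 (1 \<cdot>\<^sub>v v - b \<cdot>\<^sub>v y) = 0\<^sub>v N"
        unfolding adj_mult_vec_diff[OF M0 yN vN] using y v by (intro eq_vecI) (auto simp: L)
      with ne have "left_eigenvector M0 (1 \<cdot>\<^sub>v v - b \<cdot>\<^sub>v y)" using vN yN by (simp add: L)
      then have "bilin (1 \<cdot>\<^sub>v v - b \<cdot>\<^sub>v y) M1 x \<noteq> 0" by (rule nz[OF x])
      moreover have "bilin (1 \<cdot>\<^sub>v v - b \<cdot>\<^sub>v y) M1 x = 0"
        unfolding bilin_diff_left[OF M1 xN yN vN] using nxy by (simp add: b_def)
      ultimately show False by simp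
    qed
    then have "(1 \<cdot>\<^sub>v v - b \<cdot>\<^sub>v y) $ r = 0" if "r < N" for r using that by simp
    then have vy: "v = b \<cdot>\<^sub>v y" using vN yN by (intro eq_vecI) auto
    have "a \<noteq> 0" "b \<noteq> 0" using nz[OF u y] nz[OF x v] nxy by (auto simp: a_def b_def)
    then show ?thesis unfolding ux vy
      by (simp add: vec_norm2_smult bilin_smult[OF M1 xN yN] norm_mult)
  qed
  have dimW0: "dim_row W0 = N" using W0 by simp
  show ?thesis
    unfolding eigenvalue_cond_def M0_def[symmetric] M1_def[symmetric] dimW0
    using simple x y nz[OF x y] by (intro the_equality) (blast, metis unique)
qed

section \<open>Scalar bidiagonal systems\<close>

lemma sum_shift_down:
  fixes f z :: "nat \<Rightarrow> complex"
  shows "(\<Sum>i\<le>d. f i * (if i = 0 then 0 else z (i - 1))) = (\<Sum>j<d. f (Suc j) * z j)"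
  using sum.atMost_Suc_shift[of "\<lambda>i. f i * (if i = 0 then 0 else z (i - 1))" "d - 1"]
  by (cases d) (simp_all flip: lessThan_Suc_atMost del: sum.lessThan_Suc)

lemma sum_truncate:
  fixes f z :: "nat \<Rightarrow> complex"
  shows "(\<Sum>i\<le>d. f i * (if i < d then z i else 0)) = (\<Sum>j<d. f j * z j)"
  by (simp flip: lessThan_Suc_atMost)

text \<open>The row \<open>(\<lambda>\<^sup>i \<mu>\<^sup>d\<^sup>-\<^sup>i)\<close> annihilates the bidiagonal \<open>(d + 1) \<times> d\<close> matrix with \<open>- \<lambda>\<close> on the
  diagonal and \<open>\<mu>\<close> below it. The conditionals in the summand are the entries of that matrix
  applied to \<open>z\<close>.\<close>

lemma hom_row_annihilates:
  fixes z :: "nat \<Rightarrow> complex"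
  shows "(\<Sum>i\<le>d. lam ^ i * mu ^ (d - i) *
      (mu * (if i = 0 then 0 else z (i - 1)) - lam * (if i < d then z i else 0))) = 0"
proof -
  have "(\<Sum>i\<le>d. lam ^ i * mu ^ (d - i) *
      (mu * (if i = 0 then 0 else z (i - 1)) - lam * (if i < d then z i else 0)))
    = (\<Sum>i\<le>d. (lam ^ i * mu ^ (d - i) * mu) * (if i = 0 then 0 else z (i - 1)))
      - (\<Sum>i\<le>d. (lam ^ i * mu ^ (d - i) * lam) * (if i < d then z i else 0))"
    by (simp add: right_diff_distrib sum_subtractf mult.assoc)
  also have "\<dots> = (\<Sum>j<d. lam ^ Suc j * mu ^ (d - Suc j) * mu * z j)
      - (\<Sum>j<d. lam ^ j * mu ^ (d - j) * lam * z j)"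
    by (simp only: sum_shift_down[of _ z] sum_truncate)
  also have "\<dots> = 0"
    by (auto simp: mult_ac Suc_diff_Suc[symmetric] simp flip: sum_subtractf intro!: sum.neutral)
  finally show ?thesis .
qed

text \<open>The derivative of the preceding relation in the direction \<open>(a, - b)\<close>. Differentiating the
  row on the left is the same as differentiating the bidiagonal matrix on the right, up to sign.\<close>

lemma hom_row_derivative:
  fixes z :: "nat \<Rightarrow> complex"
  shows "(\<Sum>i\<le>d. (a * (of_nat i * lam ^ (i - 1) * mu ^ (d - i))
                - b * (lam ^ i * (of_nat (d - i) * mu ^ (d - i - 1)))) *
           (mu * (if i = 0 then 0 else z (i - 1)) - lam * (if i < d then z i else 0)))
       = (\<Sum>i\<le>d. lam ^ i * mu ^ (d - i) *
           (b * (if i = 0 then 0 else z (i - 1)) + a * (if i < d then z i else 0)))"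
    (is "?L = ?R")
proof -
  let ?c = "\<lambda>i. a * (of_nat i * lam ^ (i - 1) * mu ^ (d - i))
                - b * (lam ^ i * (of_nat (d - i) * mu ^ (d - i - 1)))"
  have "?L = (\<Sum>i\<le>d. (?c i * mu) * (if i = 0 then 0 else z (i - 1)))
      - (\<Sum>i\<le>d. (?c i * lam) * (if i < d then z i else 0))"
    by (simp add: right_diff_distrib sum_subtractf mult.assoc)
  also have "\<dots> = (\<Sum>j<d. (?c (Suc j) * mu) * z j) - (\<Sum>j<d. (?c j * lam) * z j)"
    by (simp only: sum_shift_down[of _ z] sum_truncate)
  also have "\<dots> = (\<Sum>j<d. (lam ^ Suc j * mu ^ (d - Suc j) * b) * z j)
      + (\<Sum>j<d. (lam ^ j * mu ^ (d - j) * a) * z j)"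
    unfolding sum_subtractf[symmetric] sum.distrib[symmetric]
  proof (rule sum.cong)
    fix j assume "j \<in> {..<d}"
    then obtain e where d: "d = Suc (j + e)" using less_iff_Suc_add by auto
    show "?c (Suc j) * mu * z j - ?c j * lam * z j
       = lam ^ Suc j * mu ^ (d - Suc j) * b * z j + lam ^ j * mu ^ (d - j) * a * z j"
      unfolding d by (cases j; cases e) (simp_all add: algebra_simps)
  qed simp
  also have "\<dots> = (\<Sum>i\<le>d. (lam ^ i * mu ^ (d - i) * b) * (if i = 0 then 0 else z (i - 1)))
      + (\<Sum>i\<le>d. (lam ^ i * mu ^ (d - i) * a) * (if i < d then z i else 0))"
    by (simp only: sum_shift_down[of _ z] sum_truncate)
  also have "\<dots> = ?R"
    by (simp add: distrib_left sum.distrib mult.assoc)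
  finally show ?thesis .
qed

lemma tri_norm_nonneg: "0 \<le> tri_norm d"
  unfolding tri_norm_def by (rule spectral_norm_nonneg)

lemma tri_norm_upper_sums:
  fixes b :: "nat \<Rightarrow> real"
  shows "(\<Sum>j<d. (\<Sum>i\<in>{j..<d}. b i)\<^sup>2) \<le> (tri_norm d)\<^sup>2 * (\<Sum>i<d. (b i)\<^sup>2)"
proof -
  let ?U = "mat d d (\<lambda>(i, j). if i \<le> j then 1 else 0) :: complex mat"
  define v where "v = vec d (\<lambda>i. complex_of_real (b i))"
  have "vec_norm2 (?U *\<^sub>v v) \<le> tri_norm d * vec_norm2 v"
    unfolding tri_norm_def by (rule spectral_norm_bound) (simp add: v_def)
  then have "(vec_norm2 (?U *\<^sub>v v))\<^sup>2 \<le> (tri_norm d * vec_norm2 v)\<^sup>2"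
    by (rule power_mono) (rule vec_norm2_nonneg)
  moreover have "(?U *\<^sub>v v) $ j = complex_of_real (\<Sum>i\<in>{j..<d}. b i)" if "j < d" for j
  proof -
    have "(?U *\<^sub>v v) $ j = (\<Sum>i\<in>{0..<d}. if j \<le> i then complex_of_real (b i) else 0)"
      using that by (auto simp: v_def scalar_prod_def intro!: sum.cong)
    also have "\<dots> = (\<Sum>i\<in>{0..<d} \<inter> {i. j \<le> i}. complex_of_real (b i))"
      by (simp add: sum.inter_restrict)
    also have "{0..<d} \<inter> {i. j \<le> i} = {j..<d}" by auto
    finally show ?thesis by simp
  qed
  ultimately show ?thesis
    by (simp add: power_mult_distrib vec_norm2_square v_def del: index_mult_mat_vec of_real_sum)
qed

text \<open>The lower triangular matrix of ones has norm \<open>T(d)\<close> as well: reversing the order of the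
  coordinates on both sides turns it into the upper triangular one.\<close>

lemma tri_norm_lower_sums:
  fixes b :: "nat \<Rightarrow> real"
  shows "(\<Sum>j<d. (\<Sum>i\<le>j. b i)\<^sup>2) \<le> (tri_norm d)\<^sup>2 * (\<Sum>i<d. (b i)\<^sup>2)"
proof -
  have "(\<Sum>j<d. (\<Sum>i\<le>j. b i)\<^sup>2) = (\<Sum>j<d. (\<Sum>i\<le>d - Suc j. b i)\<^sup>2)"
    by (rule sum.nat_diff_reindex[symmetric])
  also have "\<dots> = (\<Sum>j<d. (\<Sum>i\<in>{j..<d}. b (d - Suc i))\<^sup>2)"
  proof (rule sum.cong)
    fix j assume "j \<in> {..<d}"
    then have "(\<Sum>i\<le>d - Suc j. b i) = (\<Sum>i\<in>{j..<d}. b (d - Suc i))"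
      by (intro sum.reindex_bij_witness[of _ "\<lambda>i. d - Suc i" "\<lambda>i. d - Suc i"]) auto
    then show "(\<Sum>i\<le>d - Suc j. b i)\<^sup>2 = (\<Sum>i\<in>{j..<d}. b (d - Suc i))\<^sup>2" by simp
  qed simp
  also have "\<dots> \<le> (tri_norm d)\<^sup>2 * (\<Sum>i<d. (b (d - Suc i))\<^sup>2)"
    by (rule tri_norm_upper_sums)
  also have "(\<Sum>i<d. (b (d - Suc i))\<^sup>2) = (\<Sum>i<d. (b i)\<^sup>2)"
    by (rule sum.nat_diff_reindex)
  finally show ?thesis .
qed

text \<open>Forward substitution. The system is \<open>- \<lambda> z\<^sub>0 = b\<^sub>0\<close>, \<open>\<mu> z\<^sub>j - \<lambda> z\<^sub>j\<^sub>+\<^sub>1 = b\<^sub>j\<^sub>+\<^sub>1\<close>, closed by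
  \<open>\<mu> z\<^sub>d\<^sub>-\<^sub>1 = b\<^sub>d\<close>, which is what the solvability condition provides. When \<open>\<bar>\<mu>\<bar> \<le> \<bar>\<lambda>\<bar>\<close>, no term is
  amplified and \<open>\<bar>\<lambda>\<bar> \<bar>z\<^sub>j\<bar>\<close> is at most the sum of the \<open>\<bar>b\<^sub>i\<bar>\<close> with \<open>i \<le> j\<close>; this gives \<open>T(d)\<close>, and the
  factor \<open>2\<close> comes from \<open>\<bar>\<lambda>\<bar>\<^sup>2 \<ge> 1/2\<close>.\<close>

lemma bidiagonal_solve_dominant:
  fixes b :: "nat \<Rightarrow> complex"
  assumes d: "d \<ge> 1" and nrm: "(cmod lam)\<^sup>2 + (cmod mu)\<^sup>2 = 1" and le: "cmod mu \<le> cmod lam"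
    and sum0: "(\<Sum>i\<le>d. lam ^ i * mu ^ (d - i) * b i) = 0"
  shows "\<exists>z. (\<forall>i\<le>d. mu * (if i = 0 then 0 else z (i - 1)) - lam * (if i < d then z i else 0) = b i) \<and>
             (\<Sum>j<d. (cmod (z j))\<^sup>2) \<le> 2 * (tri_norm d)\<^sup>2 * (\<Sum>i\<le>d. (cmod (b i))\<^sup>2)"
proof -
  have "(cmod mu)\<^sup>2 \<le> (cmod lam)\<^sup>2" using le by (rule power_mono) simp
  then have half: "1 \<le> 2 * (cmod lam)\<^sup>2" using nrm by linarith
  then have lam: "lam \<noteq> 0" by auto
  define z where "z = rec_nat (- b 0 / lam) (\<lambda>j w. (mu * w - b (Suc j)) / lam)"
  have z0: "lam * z 0 = - b 0" using lam by (simp add: z_def)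
  have zS: "lam * z (Suc j) = mu * z j - b (Suc j)" for j using lam by (simp add: z_def)
  have closed: "lam ^ Suc j * z j = - (\<Sum>i\<le>j. lam ^ i * mu ^ (j - i) * b i)" for j
  proof (induction j)
    case 0
    then show ?case using z0 by simp
  next
    case (Suc j)
    have "lam ^ Suc (Suc j) * z (Suc j) = lam ^ Suc j * (lam * z (Suc j))" by (simp add: mult_ac)
    also have "\<dots> = mu * (lam ^ Suc j * z j) - lam ^ Suc j * b (Suc j)"
      unfolding zS by (simp add: algebra_simps)
    also have "mu * (lam ^ Suc j * z j) = - (\<Sum>i\<le>j. lam ^ i * mu ^ (Suc j - i) * b i)"
      unfolding Suc.IH by (auto simp: sum_distrib_left Suc_diff_le mult_ac intro!: sum.cong)
    finally show ?case by simp
  qed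
  have bound: "cmod lam * cmod (z j) \<le> (\<Sum>i\<le>j. cmod (b i))" for j
  proof (induction j)
    case 0
    then show ?case using z0 by (simp flip: norm_mult)
  next
    case (Suc j)
    have "cmod lam * cmod (z (Suc j)) = cmod (mu * z j - b (Suc j))"
      unfolding zS[symmetric] by (simp add: norm_mult)
    also have "\<dots> \<le> cmod mu * cmod (z j) + cmod (b (Suc j))"
      by (metis norm_triangle_ineq4 norm_mult)
    also have "\<dots> \<le> cmod lam * cmod (z j) + cmod (b (Suc j))"
      using le by (simp add: mult_right_mono)
    finally show ?case using Suc.IH by simp
  qed
  have last: "mu * z (d - 1) = b d"
  proof -
    from d obtain e where e: "d = Suc e" by (cases d) auto
    have "lam ^ d * (mu * z e) = mu * (lam ^ Suc e * z e)" by (simp add: e mult_ac)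
    also have "\<dots> = - (\<Sum>i\<le>e. lam ^ i * mu ^ (d - i) * b i)"
      unfolding closed by (auto simp: e sum_distrib_left Suc_diff_le mult_ac intro!: sum.cong)
    also have "\<dots> = lam ^ d * b d"
      using sum0 by (simp add: e add_eq_0_iff2)
    finally show ?thesis using lam e by simp
  qed
  have eqs: "mu * (if i = 0 then 0 else z (i - 1)) - lam * (if i < d then z i else 0) = b i"
    if "i \<le> d" for i
  proof (cases i)
    case 0
    then show ?thesis using z0 d by simp
  next
    case (Suc j)
    then show ?thesis
      using that zS[of j] last by (cases "i = d") simp_all
  qed
  have "(\<Sum>j<d. (cmod (z j))\<^sup>2) \<le> (\<Sum>j<d. 2 * (\<Sum>i\<le>j. cmod (b i))\<^sup>2)"
  proof (rule sum_mono)
    fix j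
    have "(cmod (z j))\<^sup>2 * 1 \<le> (cmod (z j))\<^sup>2 * (2 * (cmod lam)\<^sup>2)"
      using half by (intro mult_left_mono) auto
    also have "\<dots> = 2 * (cmod lam * cmod (z j))\<^sup>2" by (simp add: power_mult_distrib)
    also have "\<dots> \<le> 2 * (\<Sum>i\<le>j. cmod (b i))\<^sup>2"
      using bound[of j] by (simp add: power_mono)
    finally show "(cmod (z j))\<^sup>2 \<le> 2 * (\<Sum>i\<le>j. cmod (b i))\<^sup>2" by simp
  qed
  also have "\<dots> = 2 * (\<Sum>j<d. (\<Sum>i\<le>j. cmod (b i))\<^sup>2)" by (simp add: sum_distrib_left)
  also have "\<dots> \<le> 2 * ((tri_norm d)\<^sup>2 * (\<Sum>i<d. (cmod (b i))\<^sup>2))"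
    using tri_norm_lower_sums by (intro mult_left_mono) auto
  also have "\<dots> \<le> 2 * ((tri_norm d)\<^sup>2 * (\<Sum>i\<le>d. (cmod (b i))\<^sup>2))"
    by (intro mult_left_mono sum_mono2) auto
  finally show ?thesis using eqs by (intro exI[of _ z]) (auto simp: mult.assoc)
qed

text \<open>If \<open>\<bar>\<lambda>\<bar> < \<bar>\<mu>\<bar>\<close>, the substitution has to run backwards: reversing the order of equations and
  unknowns exchanges \<open>\<lambda>\<close> and \<open>\<mu>\<close> and changes the sign of the right-hand side.\<close>

lemma bidiagonal_solve:
  fixes b :: "nat \<Rightarrow> complex"
  assumes d: "d \<ge> 1" and nrm: "(cmod lam)\<^sup>2 + (cmod mu)\<^sup>2 = 1"
    and sum0: "(\<Sum>i\<le>d. lam ^ i * mu ^ (d - i) * b i) = 0"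
  shows "\<exists>z. (\<forall>i\<le>d. mu * (if i = 0 then 0 else z (i - 1)) - lam * (if i < d then z i else 0) = b i) \<and>
             (\<Sum>j<d. (cmod (z j))\<^sup>2) \<le> 2 * (tri_norm d)\<^sup>2 * (\<Sum>i\<le>d. (cmod (b i))\<^sup>2)"
proof (cases "cmod mu \<le> cmod lam")
  case True
  then show ?thesis using bidiagonal_solve_dominant[OF d nrm _ sum0] by simp
next
  case False
  have rev: "(\<Sum>i\<le>d. f (d - i)) = (\<Sum>i\<le>d. f i)" for f :: "nat \<Rightarrow> 'a :: comm_monoid_add"
    by (rule sum.reindex_bij_witness[of _ "\<lambda>i. d - i" "\<lambda>i. d - i"]) auto
  have "(\<Sum>i\<le>d. mu ^ i * lam ^ (d - i) * - b (d - i)) = (\<Sum>i\<le>d. - (lam ^ i * mu ^ (d - i) * b i))"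
    unfolding rev[of "\<lambda>i. - (lam ^ i * mu ^ (d - i) * b i)", symmetric]
    by (intro sum.cong) (auto simp: mult_ac)
  then have "(\<Sum>i\<le>d. mu ^ i * lam ^ (d - i) * - b (d - i)) = 0" using sum0 by (simp add: sum_negf)
  moreover have "(cmod mu)\<^sup>2 + (cmod lam)\<^sup>2 = 1" "cmod lam \<le> cmod mu" using nrm False by auto
  ultimately obtain z where
    z: "\<And>i. i \<le> d \<Longrightarrow> lam * (if i = 0 then 0 else z (i - 1)) - mu * (if i < d then z i else 0) = - b (d - i)"
    and zb: "(\<Sum>j<d. (cmod (z j))\<^sup>2) \<le> 2 * (tri_norm d)\<^sup>2 * (\<Sum>i\<le>d. (cmod (- b (d - i)))\<^sup>2)"
    using bidiagonal_solve_dominant[OF d, of mu lam "\<lambda>i. - b (d - i)"] by blast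
  let ?z = "\<lambda>j. z (d - Suc j)"
  have sol: "mu * (if i = 0 then 0 else ?z (i - 1)) - lam * (if i < d then ?z i else 0) = b i"
    if i: "i \<le> d" for i
  proof -
    have "lam * (if i = d then 0 else z (d - i - 1)) - mu * (if i = 0 then 0 else z (d - i)) = - b i"
    proof -
      have "(d - i = 0) = (i = d)" "(d - i < d) = (i \<noteq> 0)" using i d by auto
      then show ?thesis using z[of "d - i"] i d by (cases "i = 0"; cases "i = d") simp_all
    qed
    moreover have "d - Suc (i - 1) = d - i" if "i \<noteq> 0" using that i by simp
    ultimately show ?thesis using i by (auto simp: algebra_simps split: if_splits)
  qed
  have bd: "(\<Sum>j<d. (cmod (?z j))\<^sup>2) \<le> 2 * (tri_norm d)\<^sup>2 * (\<Sum>i\<le>d. (cmod (b i))\<^sup>2)"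
    using zb unfolding sum.nat_diff_reindex[of "\<lambda>j. (cmod (z j))\<^sup>2"] norm_minus_cancel
      rev[of "\<lambda>i. (cmod (b i))\<^sup>2"] .
  show ?thesis
    by (rule exI[of _ ?z], intro conjI allI impI) (rule sol bd, assumption?)+
qed

section \<open>Block shifts and coefficient columns\<close>

text \<open>Vectors of length \<open>m n\<close> are treated as \<open>m\<close> blocks of length \<open>n\<close>; the entry at \<open>i n + k\<close> is
  the \<open>k\<close>-th entry of block \<open>i\<close>.\<close>

lemma sum_blocks:
  fixes f :: "nat \<Rightarrow> 'a :: comm_monoid_add"
  shows "(\<Sum>r<m * n. f r) = (\<Sum>i<m. \<Sum>k<n. f (i * n + k))"
proof -
  have "(\<Sum>i<m. \<Sum>k<n. f (i * n + k)) = (\<Sum>i<m. sum f {i * n..<i * n + n})"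
  proof (rule sum.cong)
    fix i
    show "(\<Sum>k<n. f (i * n + k)) = sum f {i * n..<i * n + n}"
      by (rule sum.reindex_bij_witness[of _ "\<lambda>r. r - i * n" "\<lambda>k. i * n + k"]) auto
  qed simp
  then show ?thesis by (simp add: sum.nat_group)
qed

lemma sum_blocks_Suc:
  fixes f :: "nat \<Rightarrow> 'a :: comm_monoid_add"
  shows "(\<Sum>r<(d + 1) * n. f r) = (\<Sum>k<n. \<Sum>i\<le>d. f (i * n + k))"
  unfolding sum_blocks by (subst sum.swap) (simp add: lessThan_Suc_atMost)

lemma block_index_less: "i * n + k < m * n" if "i < m" "k < n" for i k m n :: nat
proof -
  have "i * n + k < Suc i * n" using that by simp
  also have "\<dots> \<le> m * n" using that by (intro mult_right_mono) auto
  finally show ?thesis .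
qed

lemma append_cols_carrier:
  "P \<in> carrier_mat m a \<Longrightarrow> Q \<in> carrier_mat m b \<Longrightarrow> P @\<^sub>c Q \<in> carrier_mat m (a + b)"
  unfolding append_cols_def by (intro carrier_matI) auto

lemma append_rows_mult_append_cols:
  fixes V W P Q :: "'a :: semiring_1 mat"
  assumes "V \<in> carrier_mat a m" "W \<in> carrier_mat b m" "P \<in> carrier_mat m p" "Q \<in> carrier_mat m q"
  shows "(V @\<^sub>r W) * (P @\<^sub>c Q) = four_block_mat (V * P) (V * Q) (W * P) (W * Q)"
proof -
  have "(V @\<^sub>r W) * (P @\<^sub>c Q) =
    four_block_mat (V * P + 0\<^sub>m a 0 * 0\<^sub>m 0 p) (V * Q + 0\<^sub>m a 0 * 0\<^sub>m 0 q)
      (W * P + 0\<^sub>m b 0 * 0\<^sub>m 0 p) (W * Q + 0\<^sub>m b 0 * 0\<^sub>m 0 q)"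
    unfolding append_rows_def append_cols_def using assms
    by (subst mult_four_block_mat[of _ a m _ 0 _ b _ _ p _ q]) auto
  then show ?thesis using assms by simp
qed

lemma append_cols_mult_append_rows:
  fixes V W P Q :: "'a :: semiring_1 mat"
  assumes "V \<in> carrier_mat a m" "W \<in> carrier_mat b m" "P \<in> carrier_mat m a" "Q \<in> carrier_mat m b"
  shows "(P @\<^sub>c Q) * (V @\<^sub>r W) = P * V + Q * W"
proof -
  have "(P @\<^sub>c Q) * (V @\<^sub>r W) =
    four_block_mat (P * V + Q * W) (P * 0\<^sub>m a 0 + Q * 0\<^sub>m b 0)
      (0\<^sub>m 0 a * V + 0\<^sub>m 0 b * W) (0\<^sub>m 0 a * 0\<^sub>m a 0 + 0\<^sub>m 0 b * 0\<^sub>m b 0)"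
    unfolding append_rows_def append_cols_def using assms
    by (subst mult_four_block_mat[of _ m a _ b _ 0 _ _ m _ 0]) auto
  also have "\<dots> = P * V + Q * W" using assms by (intro eq_matI) auto
  finally show ?thesis .
qed

lemma smult_mat_mult_vec:
  fixes M :: "'a :: comm_semiring_0 mat"
  assumes "dim_vec v = dim_col M"
  shows "(k \<cdot>\<^sub>m M) *\<^sub>v v = k \<cdot>\<^sub>v (M *\<^sub>v v)"
  using assms by (intro eq_vecI) (auto simp: scalar_prod_def sum_distrib_left mult.assoc)

text \<open>With \<open>b = \<mu>\<close> and \<open>a = - \<lambda>\<close> this is the bidiagonal matrix \<open>G\<close>, Kronecker the identity, for
  which the pencil is \<open>W G\<close>. The two parameters are kept free because the denominator of the
  condition number contains \<open>W\<close> times the matrix with \<open>b = cnj \<lambda>\<close> and \<open>a = cnj \<mu>\<close>.\<close>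

definition shift_mat :: "nat \<Rightarrow> nat \<Rightarrow> complex \<Rightarrow> complex \<Rightarrow> complex mat" where
  "shift_mat n d b a =
     b \<cdot>\<^sub>m (0\<^sub>m n (d * n) @\<^sub>r 1\<^sub>m (d * n)) + a \<cdot>\<^sub>m (1\<^sub>m (d * n) @\<^sub>r 0\<^sub>m n (d * n))"

lemma shift_blocks_carrier:
  "(0\<^sub>m n (d * n) @\<^sub>r 1\<^sub>m (d * n) :: complex mat) \<in> carrier_mat ((d + 1) * n) (d * n)"
  "(1\<^sub>m (d * n) @\<^sub>r 0\<^sub>m n (d * n) :: complex mat) \<in> carrier_mat ((d + 1) * n) (d * n)"
  using carrier_append_rows[of "0\<^sub>m n (d * n)" n "d * n" "1\<^sub>m (d * n)" "d * n"]
    carrier_append_rows[of "1\<^sub>m (d * n)" "d * n" "d * n" "0\<^sub>m n (d * n)" n]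
  by (simp_all add: add.commute)

lemma shift_mat_carrier: "shift_mat n d b a \<in> carrier_mat ((d + 1) * n) (d * n)"
  unfolding shift_mat_def by (intro add_carrier_mat smult_carrier_mat shift_blocks_carrier)

lemma shift_mat_entry:
  assumes "r < (d + 1) * n" "c < d * n"
  shows "shift_mat n d b a $$ (r, c) = b * (if r = c + n then 1 else 0) + a * (if r = c then 1 else 0)"
proof -
  have "r < d * n" if "r < n" using that assms(2) by (cases d) auto
  then show ?thesis using assms by (auto simp: shift_mat_def append_rows_def)
qed

lemma shift_block_mult_vec:
  assumes "v \<in> carrier_vec (d * n)"
  shows "((0\<^sub>m n (d * n) @\<^sub>r 1\<^sub>m (d * n)) :: complex mat) *\<^sub>v v = 0\<^sub>v n @\<^sub>v v"
    "((1\<^sub>m (d * n) @\<^sub>r 0\<^sub>m n (d * n)) :: complex mat) *\<^sub>v v = v @\<^sub>v 0\<^sub>v n"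
  using assms by (subst mat_mult_append[of _ _ "d * n"]; auto)+

lemma shift_mat_mult_vec_block:
  assumes v: "v \<in> carrier_vec (d * n)" and i: "i \<le> d" and k: "k < n"
  shows "(shift_mat n d b a *\<^sub>v v) $ (i * n + k) =
    b * (if i = 0 then 0 else v $ ((i - 1) * n + k)) + a * (if i < d then v $ (i * n + k) else 0)"
proof -
  have r: "i * n + k < (d + 1) * n" using i k by (intro block_index_less) auto
  have "shift_mat n d b a *\<^sub>v v = b \<cdot>\<^sub>v (0\<^sub>v n @\<^sub>v v) + a \<cdot>\<^sub>v (v @\<^sub>v 0\<^sub>v n)"
    unfolding shift_mat_def
    using v shift_block_mult_vec[OF v] shift_blocks_carrier[where n = n and d = d]
    by (subst add_mult_distrib_mat_vec[of _ "(d + 1) * n" "d * n"])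
       (auto simp: smult_mat_mult_vec carrier_matD[OF shift_blocks_carrier(1)]
          carrier_matD[OF shift_blocks_carrier(2)])
  moreover have "(0\<^sub>v n @\<^sub>v v) $ (i * n + k) = (if i = 0 then 0 else v $ ((i - 1) * n + k))"
  proof (cases i)
    case (Suc j)
    then show ?thesis using v r by (auto simp: index_append_vec)
  qed (use v k in auto)
  moreover have "(v @\<^sub>v 0\<^sub>v n) $ (i * n + k) = (if i < d then v $ (i * n + k) else 0)"
  proof (cases "i < d")
    case True
    then show ?thesis using v r block_index_less[OF True k] by (auto simp: index_append_vec)
  next
    case False
    then have "i = d" using i by simp
    then show ?thesis using v r k by (auto simp: index_append_vec)
  qed
  ultimately show ?thesis using v r by simp
qed

lemma mult_shift_mat:
  assumes W: "W \<in> carrier_mat m ((d + 1) * n)"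
  shows "W * shift_mat n d b a = b \<cdot>\<^sub>m pencil_W0 n d W + a \<cdot>\<^sub>m pencil_W1 n d W"
  unfolding shift_mat_def pencil_W0_def pencil_W1_def
  by (subst mult_add_distrib_mat[OF W smult_carrier_mat smult_carrier_mat,
        OF shift_blocks_carrier(1) shift_blocks_carrier(2)])
     (simp only: mult_smult_distrib[OF W shift_blocks_carrier(1)]
        mult_smult_distrib[OF W shift_blocks_carrier(2)])

lemma pencil_carrier:
  assumes "W \<in> carrier_mat m ((d + 1) * n)"
  shows "pencil_W0 n d W \<in> carrier_mat m (d * n)" "pencil_W1 n d W \<in> carrier_mat m (d * n)"
  unfolding pencil_W0_def pencil_W1_def
  by (rule mult_carrier_mat[OF assms shift_blocks_carrier(1)])
     (rule mult_carrier_mat[OF assms shift_blocks_carrier(2)])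

lemma pencil_eq_mult_shift:
  assumes W: "W \<in> carrier_mat m ((d + 1) * n)"
  shows "mu \<cdot>\<^sub>m pencil_W0 n d W - lam \<cdot>\<^sub>m pencil_W1 n d W = W * shift_mat n d mu (- lam)"
  unfolding mult_shift_mat[OF W] using pencil_carrier[OF W] by (intro eq_matI) auto

lemma coeff_column_carrier: "coeff_column n d A \<in> carrier_mat ((d + 1) * n) n"
  by (simp add: coeff_column_def)

lemma coeff_column_mult_vec_block:
  assumes A: "\<And>i. i \<le> d \<Longrightarrow> A i \<in> carrier_mat n n" and v: "v \<in> carrier_vec n"
    and "i \<le> d" "k < n"
  shows "(coeff_column n d A *\<^sub>v v) $ (i * n + k) = (A i *\<^sub>v v) $ k"
proof -
  have r: "i * n + k < (d + 1) * n" using assms(3,4) by (intro block_index_less) auto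
  then show ?thesis
    using A[OF assms(3)] v assms(4) by (simp add: coeff_column_def scalar_prod_def)
qed

text \<open>Both \<open>A(\<lambda>, \<mu>)\<close> and its partial derivatives are combinations \<open>\<Sum> f\<^sub>i A\<^sub>i\<close> of the
  coefficients, and \<open>A\<^sub>i v\<close> is block \<open>i\<close> of the coefficient column applied to \<open>v\<close>.\<close>

lemma combination_mult_vec:
  assumes A: "\<And>i. i \<le> d \<Longrightarrow> A i \<in> carrier_mat n n" and v: "v \<in> carrier_vec n" and k: "k < n"
    and M: "M \<in> carrier_mat n n"
    and entry: "\<And>c. c < n \<Longrightarrow> M $$ (k, c) = (\<Sum>i\<le>d. f i * A i $$ (k, c))"
  shows "(M *\<^sub>v v) $ k = (\<Sum>i\<le>d. f i * (coeff_column n d A *\<^sub>v v) $ (i * n + k))"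
proof -
  have "(M *\<^sub>v v) $ k = (\<Sum>c<n. (\<Sum>i\<le>d. f i * A i $$ (k, c)) * v $ c)"
    using k M v entry by (auto simp: scalar_prod_def lessThan_atLeast0 intro!: sum.cong)
  also have "\<dots> = (\<Sum>i\<le>d. \<Sum>c<n. f i * A i $$ (k, c) * v $ c)"
    unfolding sum_distrib_right by (rule sum.swap)
  also have "\<dots> = (\<Sum>i\<le>d. f i * (A i *\<^sub>v v) $ k)"
  proof (rule sum.cong)
    fix i assume "i \<in> {..d}"
    then have "A i \<in> carrier_mat n n" using A by simp
    then show "(\<Sum>c<n. f i * A i $$ (k, c) * v $ c) = f i * (A i *\<^sub>v v) $ k"
      using k v by (simp add: scalar_prod_def lessThan_atLeast0 sum_distrib_left mult.assoc)
  qed simp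
  also have "\<dots> = (\<Sum>i\<le>d. f i * (coeff_column n d A *\<^sub>v v) $ (i * n + k))"
    using A v k by (intro sum.cong) (auto simp: coeff_column_mult_vec_block)
  finally show ?thesis .
qed

lemma mpoly_eval_mult_vec:
  assumes "\<And>i. i \<le> d \<Longrightarrow> A i \<in> carrier_mat n n" "v \<in> carrier_vec n" "k < n"
  shows "(mpoly_eval n d A lam mu *\<^sub>v v) $ k =
    (\<Sum>i\<le>d. lam ^ i * mu ^ (d - i) * (coeff_column n d A *\<^sub>v v) $ (i * n + k))"
  using assms by (intro combination_mult_vec) (auto simp: mpoly_eval_def mult_ac)

lemma D_lam_entry:
  assumes "r < n" "c < n"
  shows "D_lam n d A lam mu $$ (r, c) = (\<Sum>i\<le>d. of_nat i * lam ^ (i - 1) * mu ^ (d - i) * A i $$ (r, c))"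
proof -
  have "((\<lambda>z. \<Sum>i\<le>d. A i $$ (r, c) * z ^ i * mu ^ (d - i)) has_field_derivative
      (\<Sum>i\<le>d. of_nat i * lam ^ (i - 1) * mu ^ (d - i) * A i $$ (r, c))) (at lam)"
    by (auto intro!: derivative_eq_intros sum.cong simp: mult_ac)
  then show ?thesis using assms by (simp add: D_lam_def mpoly_eval_def DERIV_imp_deriv)
qed

lemma D_mu_entry:
  assumes "r < n" "c < n"
  shows "D_mu n d A lam mu $$ (r, c) = (\<Sum>i\<le>d. lam ^ i * (of_nat (d - i) * mu ^ (d - i - 1)) * A i $$ (r, c))"
proof -
  have "((\<lambda>z. \<Sum>i\<le>d. A i $$ (r, c) * lam ^ i * z ^ (d - i)) has_field_derivative
      (\<Sum>i\<le>d. lam ^ i * (of_nat (d - i) * mu ^ (d - i - 1)) * A i $$ (r, c))) (at mu)"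
    by (auto intro!: derivative_eq_intros sum.cong simp: mult_ac)
  then show ?thesis using assms by (simp add: D_mu_def mpoly_eval_def DERIV_imp_deriv)
qed

lemma derivative_combination_mult_vec:
  assumes "\<And>i. i \<le> d \<Longrightarrow> A i \<in> carrier_mat n n" "v \<in> carrier_vec n" "k < n"
  shows "((a \<cdot>\<^sub>m D_lam n d A lam mu - b \<cdot>\<^sub>m D_mu n d A lam mu) *\<^sub>v v) $ k =
    (\<Sum>i\<le>d. (a * (of_nat i * lam ^ (i - 1) * mu ^ (d - i))
              - b * (lam ^ i * (of_nat (d - i) * mu ^ (d - i - 1)))) *
            (coeff_column n d A *\<^sub>v v) $ (i * n + k))"
proof (rule combination_mult_vec)
  have D: "D_lam n d A lam mu \<in> carrier_mat n n" "D_mu n d A lam mu \<in> carrier_mat n n"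
    by (simp_all add: D_lam_def D_mu_def)
  then show "a \<cdot>\<^sub>m D_lam n d A lam mu - b \<cdot>\<^sub>m D_mu n d A lam mu \<in> carrier_mat n n"
    by (intro minus_carrier_mat smult_carrier_mat)
  fix c assume "c < n"
  then show "(a \<cdot>\<^sub>m D_lam n d A lam mu - b \<cdot>\<^sub>m D_mu n d A lam mu) $$ (k, c) =
      (\<Sum>i\<le>d. (a * (of_nat i * lam ^ (i - 1) * mu ^ (d - i))
              - b * (lam ^ i * (of_nat (d - i) * mu ^ (d - i - 1)))) * A i $$ (k, c))"
    using D assms(3)
    by (simp add: D_lam_entry D_mu_entry left_diff_distrib sum_subtractf sum_distrib_left mult.assoc)
qed (use assms in auto)

section \<open>The determinant of the linearization\<close>

lemma prod_list_diag_upper: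
  assumes "M \<in> carrier_mat m m" "\<And>i. i < m \<Longrightarrow> M $$ (i, i) = f i"
  shows "prod_list (diag_mat M) = (\<Prod>i<m. f i)"
  unfolding diag_mat_def prod_list_diag_prod
  using assms by (auto simp: prod.list_conv_set_nth lessThan_atLeast0 intro!: prod.cong)

text \<open>Replace the first block row by the combination of all block rows with the coefficients
  \<open>\<lambda>\<^sup>i \<mu>\<^sup>d\<^sup>-\<^sup>i\<close>, which is \<open>(A(\<lambda>, \<mu>) 0)\<close>. The first coefficient being \<open>\<mu>\<^sup>d\<close>, this multiplies the
  determinant by \<open>\<mu>\<^sup>d\<^sup>n\<close>, and that is also the determinant of the triangular block that remains.\<close>

lemma det_coeff_column_shift:
  assumes A: "\<And>i. i \<le> d \<Longrightarrow> A i \<in> carrier_mat n n" and mu: "mu \<noteq> 0"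
  shows "det (coeff_column n d A @\<^sub>c shift_mat n d mu (- lam)) = det (mpoly_eval n d A lam mu)"
proof -
  let ?N = "(d + 1) * n"
  let ?G = "shift_mat n d mu (- lam)" and ?C = "coeff_column n d A"
  have N: "?N = n + d * n" by simp
  define K where "K = ?C @\<^sub>c ?G"
  have K: "K \<in> carrier_mat ?N ?N"
    using append_cols_carrier[OF coeff_column_carrier[of n d A] shift_mat_carrier[of n d mu "- lam"]]
    by (simp add: K_def)
  have K_left: "K $$ (r, c) = ?C $$ (r, c)" if "r < ?N" "c < n" for r c
    using that coeff_column_carrier[of n d A] shift_mat_carrier[of n d mu "- lam"]
    by (auto simp: K_def append_cols_def)
  have K_right: "K $$ (r, n + c) = ?G $$ (r, c)" if "r < ?N" "c < d * n" for r c
    using that coeff_column_carrier[of n d A] shift_mat_carrier[of n d mu "- lam"]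
    by (auto simp: K_def append_cols_def)
  \<comment> \<open>The identity matrix with its first block row replaced by the row of monomials.\<close>
  define E where "E = mat ?N ?N (\<lambda>(r, c).
      if r < n then (if c mod n = r then lam ^ (c div n) * mu ^ (d - c div n) else 0)
      else (if r = c then 1 else 0))"
  have E: "E \<in> carrier_mat ?N ?N" by (simp add: E_def)
  have "upper_triangular E"
    by (rule upper_triangularI) (auto simp: E_def)
  then have "det E = prod_list (diag_mat E)" using E by (rule det_upper_triangular)
  also have "\<dots> = (\<Prod>i<?N. if i < n then mu ^ d else 1)"
    by (rule prod_list_diag_upper[OF E]) (auto simp: E_def)
  also have "\<dots> = (\<Prod>i\<in>{..<?N} \<inter> {i. i < n}. mu ^ d)"
    by (subst prod.If_cases) auto
  also have "{..<?N} \<inter> {i. i < n} = {..<n}" by auto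
  finally have detE: "det E = mu ^ (d * n)" by (simp add: power_mult)
  define L where "L = mat (d * n) (d * n) (\<lambda>(r, c). ?G $$ (n + r, c))"
  have L: "L \<in> carrier_mat (d * n) (d * n)" by (simp add: L_def)
  have L_entry: "L $$ (r, c) = mu * (if r = c then 1 else 0) - lam * (if n + r = c then 1 else 0)"
    if "r < d * n" "c < d * n" for r c using that by (simp add: L_def shift_mat_entry)
  have "upper_triangular L" using L by (intro upper_triangularI) (auto simp: L_entry)
  then have "det L = prod_list (diag_mat L)" using L by (rule det_upper_triangular)
  also have "\<dots> = (\<Prod>i<d * n. mu)"
  proof (rule prod_list_diag_upper[OF L])
    fix i assume "i < d * n"
    then show "L $$ (i, i) = mu" by (cases n) (simp_all add: L_entry)
  qed
  finally have detL: "det L = mu ^ (d * n)" by simp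
  define R where "R = mat (d * n) n (\<lambda>(r, c). ?C $$ (n + r, c))"
  have R: "R \<in> carrier_mat (d * n) n" by (simp add: R_def)
  have ev: "mpoly_eval n d A lam mu \<in> carrier_mat n n" by (simp add: mpoly_eval_def)
  have "E * K = four_block_mat (mpoly_eval n d A lam mu) (0\<^sub>m n (d * n)) R L" (is "_ = ?F")
  proof (rule eq_matI)
    have F: "?F \<in> carrier_mat ?N ?N" unfolding N using ev L by (rule four_block_carrier_mat)
    then show "dim_row (E * K) = dim_row ?F" "dim_col (E * K) = dim_col ?F" using E K by auto
    fix r c assume "r < dim_row ?F" "c < dim_col ?F"
    then have rc: "r < ?N" "c < ?N" using F by auto
    have EK: "(E * K) $$ (r, c) = (\<Sum>s<?N. E $$ (r, s) * K $$ (s, c))"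
      using rc E K by (simp add: scalar_prod_def lessThan_atLeast0)
    show "(E * K) $$ (r, c) = ?F $$ (r, c)"
    proof (cases "r < n")
      case False
      have "(E * K) $$ (r, c) = (\<Sum>s<?N. if s = r then K $$ (s, c) else 0)"
        unfolding EK using rc False by (intro sum.cong) (auto simp: E_def)
      also have "\<dots> = K $$ (r, c)" using rc by (subst sum.delta) auto
      also have "\<dots> = ?F $$ (r, c)"
      proof (cases "c < n")
        case True
        then show ?thesis using rc False ev L K_left[of r c] by (simp add: R_def)
      next
        case c: False
        then show ?thesis using rc False ev L K_right[of r "c - n"] by (simp add: L_def)
      qed
      finally show ?thesis .
    next
      case r: True
      have "(E * K) $$ (r, c) = (\<Sum>k<n. \<Sum>i\<le>d. E $$ (r, i * n + k) * K $$ (i * n + k, c))"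
        unfolding EK by (rule sum_blocks_Suc)
      also have "\<dots> = (\<Sum>k<n. if k = r then \<Sum>i\<le>d. lam ^ i * mu ^ (d - i) * K $$ (i * n + k, c) else 0)"
      proof (rule sum.cong)
        fix k assume k: "k \<in> {..<n}"
        have "E $$ (r, i * n + k) = (if k = r then lam ^ i * mu ^ (d - i) else 0)" if "i \<le> d" for i
          using block_index_less[of i "d + 1" k n] that k r rc by (simp add: E_def)
        then show "(\<Sum>i\<le>d. E $$ (r, i * n + k) * K $$ (i * n + k, c)) =
            (if k = r then \<Sum>i\<le>d. lam ^ i * mu ^ (d - i) * K $$ (i * n + k, c) else 0)"
          by (auto intro!: sum.cong sum.neutral)
      qed simp
      also have "\<dots> = (\<Sum>i\<le>d. lam ^ i * mu ^ (d - i) * K $$ (i * n + r, c))"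
        using r by (subst sum.delta) auto
      also have "\<dots> = ?F $$ (r, c)"
      proof (cases "c < n")
        case True
        have "K $$ (i * n + r, c) = A i $$ (r, c)" if "i \<le> d" for i
          using K_left[of "i * n + r" c] block_index_less[of i "d + 1" r n] that r True
          by (simp add: coeff_column_def)
        then show ?thesis using r True rc ev L by (simp add: mpoly_eval_def mult_ac)
      next
        case c: False
        define e where "e = c - n"
        have e: "c = n + e" "e < d * n" using c rc by (auto simp: e_def)
        \<comment> \<open>Column \<open>e\<close> of the bidiagonal matrix is its image of a unit vector.\<close>
        let ?z = "\<lambda>i. if i * n + r = e then 1 else 0 :: complex"
        have "K $$ (i * n + r, c) =
            mu * (if i = 0 then 0 else ?z (i - 1)) - lam * (if i < d then ?z i else 0)" if i: "i \<le> d" for i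
        proof -
          have "K $$ (i * n + r, c) = mu * (if i * n + r = e + n then 1 else 0) - lam * (?z i)"
            using K_right[of "i * n + r" e] block_index_less[of i "d + 1" r n] i r e
            by (simp add: shift_mat_entry)
          moreover have "(i * n + r = e + n) = (i \<noteq> 0 \<and> (i - 1) * n + r = e)"
            using r by (cases i) auto
          moreover have "i * n + r \<noteq> e" if "\<not> i < d"
            using that i e by auto
          ultimately show ?thesis by auto
        qed
        then have "(\<Sum>i\<le>d. lam ^ i * mu ^ (d - i) * K $$ (i * n + r, c)) = 0"
          using hom_row_annihilates[of lam mu d ?z] by simp
        then show ?thesis using r c rc ev L by simp
      qed
      finally show ?thesis .
    qed
  qed
  then have "det E * det K = det (four_block_mat (mpoly_eval n d A lam mu) (0\<^sub>m n (d * n)) R L)"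
    using det_mult[OF E K] by simp
  also have "\<dots> = det (mpoly_eval n d A lam mu) * det L"
    by (rule det_four_block_mat_upper_right_zero[OF ev refl R L])
  finally show ?thesis using mu unfolding detE detL K_def by simp
qed

text \<open>Leaving out \<open>b = 0\<close> allows determinant identities to be proved by dividing by powers of
  the second variable.\<close>

lemma bipoly_eqI:
  fixes p q :: "complex poly poly"
  assumes "\<And>a b. b \<noteq> 0 \<Longrightarrow> poly (poly p [:a:]) b = poly (poly q [:a:]) b"
  shows "p = q"
proof -
  have inner: "poly (p - q) [:a:] = 0" for a
  proof (rule ccontr)
    assume "poly (p - q) [:a:] \<noteq> 0"
    then have "finite {b. poly (poly (p - q) [:a:]) b = 0}" by (rule poly_roots_finite)
    moreover have "UNIV - {0} \<subseteq> {b. poly (poly (p - q) [:a:]) b = 0}" using assms by auto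
    ultimately have "finite (UNIV - {0 :: complex})" by (rule rev_finite_subset)
    then show False by (simp add: infinite_UNIV_char_0)
  qed
  have "p - q = 0"
  proof (rule ccontr)
    assume "p - q \<noteq> 0"
    then have "finite {c. poly (p - q) c = 0}" by (rule poly_roots_finite)
    moreover have "range (\<lambda>a. [:a:]) \<subseteq> {c. poly (p - q) c = 0}" using inner by blast
    ultimately have "finite (range (\<lambda>a :: complex. [:a:]))" by (rule rev_finite_subset)
    then show False using finite_imageD[of "\<lambda>a :: complex. [:a:]" UNIV]
      by (auto simp: inj_on_def infinite_UNIV_char_0)
  qed
  then show ?thesis by simp
qed

lemma biorthogonal_blocks:
  fixes C V W B :: "complex mat"
  assumes C: "C \<in> carrier_mat (n + m) n" and W: "W \<in> carrier_mat m (n + m)"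
    and V: "V \<in> carrier_mat n (n + m)" and B: "B \<in> carrier_mat (n + m) m"
    and inv: "(V @\<^sub>r W) * (C @\<^sub>c B) = 1\<^sub>m (n + m)"
  shows "V * C = 1\<^sub>m n" "C * V + B * W = 1\<^sub>m (n + m)" "det (V @\<^sub>r W) \<noteq> 0"
proof -
  have VW: "V @\<^sub>r W \<in> carrier_mat (n + m) (n + m)" using V W by (rule carrier_append_rows)
  have CB: "C @\<^sub>c B \<in> carrier_mat (n + m) (n + m)" using C B by (rule append_cols_carrier)
  show "V * C = 1\<^sub>m n"
  proof (rule eq_matI)
    fix i j assume "i < dim_row (1\<^sub>m n :: complex mat)" "j < dim_col (1\<^sub>m n :: complex mat)"
    then have ij: "i < n" "j < n" by auto
    have "four_block_mat (V * C) (V * B) (W * C) (W * B) $$ (i, j) = 1\<^sub>m (n + m) $$ (i, j)"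
      unfolding append_rows_mult_append_cols[OF V W C B, symmetric] inv ..
    then show "(V * C) $$ (i, j) = 1\<^sub>m n $$ (i, j)" using ij V W C B by simp
  qed (use V C in auto)
  have "(C @\<^sub>c B) * (V @\<^sub>r W) = 1\<^sub>m (n + m)" by (rule mat_mult_left_right_inverse[OF VW CB inv])
  then show "C * V + B * W = 1\<^sub>m (n + m)" using append_cols_mult_append_rows[OF V W C B] by simp
  have "det (V @\<^sub>r W) * det (C @\<^sub>c B) = 1" using det_mult[OF VW CB] inv by simp
  then show "det (V @\<^sub>r W) \<noteq> 0" by auto
qed

text \<open>Multiplying \<open>(V; W)\<close> with the matrix \<open>(C G)\<close> of the previous determinant formula instead of
  \<open>(C B)\<close> gives a block triangular matrix with diagonal blocks \<open>I\<close> and \<open>W G\<close>.\<close>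

lemma det_linearization:
  assumes A: "\<And>i. i \<le> d \<Longrightarrow> A i \<in> carrier_mat n n" and mu: "mu \<noteq> 0"
    and W: "W \<in> carrier_mat (d * n) ((d + 1) * n)" and V: "V \<in> carrier_mat n ((d + 1) * n)"
    and VC: "V * coeff_column n d A = 1\<^sub>m n" and WC: "W * coeff_column n d A = 0\<^sub>m (d * n) n"
  shows "det (mu \<cdot>\<^sub>m pencil_W0 n d W - lam \<cdot>\<^sub>m pencil_W1 n d W)
    = det (V @\<^sub>r W) * det (mpoly_eval n d A lam mu)"
proof -
  let ?G = "shift_mat n d mu (- lam)" and ?C = "coeff_column n d A"
  have N: "(d + 1) * n = n + d * n" by simp
  have VW: "V @\<^sub>r W \<in> carrier_mat ((d + 1) * n) ((d + 1) * n)"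
    using carrier_append_rows[OF V W] unfolding N .
  have CG: "?C @\<^sub>c ?G \<in> carrier_mat ((d + 1) * n) ((d + 1) * n)"
    using append_cols_carrier[OF coeff_column_carrier[of n d A] shift_mat_carrier[of n d mu "- lam"]]
    unfolding N .
  have VG: "V * ?G \<in> carrier_mat n (d * n)" and WG: "W * ?G \<in> carrier_mat (d * n) (d * n)"
    using V W shift_mat_carrier by (blast intro: mult_carrier_mat)+
  have "det (V @\<^sub>r W) * det (mpoly_eval n d A lam mu) = det ((V @\<^sub>r W) * (?C @\<^sub>c ?G))"
    using det_mult[OF VW CG] det_coeff_column_shift[of d A n mu lam] A mu by simp
  also have "(V @\<^sub>r W) * (?C @\<^sub>c ?G) = four_block_mat (1\<^sub>m n) (V * ?G) (0\<^sub>m (d * n) n) (W * ?G)"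
    unfolding append_rows_mult_append_cols[OF V W coeff_column_carrier shift_mat_carrier] VC WC ..
  also have "det \<dots> = det (1\<^sub>m n :: complex mat) * det (W * ?G)"
    by (rule det_four_block_mat_lower_left_zero[OF _ VG refl WG]) simp
  finally show ?thesis unfolding pencil_eq_mult_shift[OF W] by simp
qed

text \<open>The two determinants agree up to a nonzero constant, hence have the same linear factors
  with the same multiplicities.\<close>

lemma simple_eigenvalue_linearization:
  assumes A: "\<And>i. i \<le> d \<Longrightarrow> A i \<in> carrier_mat n n"
    and W: "W \<in> carrier_mat (d * n) ((d + 1) * n)" and V: "V \<in> carrier_mat n ((d + 1) * n)"
    and VC: "V * coeff_column n d A = 1\<^sub>m n" and WC: "W * coeff_column n d A = 0\<^sub>m (d * n) n"
    and det: "det (V @\<^sub>r W) \<noteq> 0"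
    and simple: "simple_eigenvalue n d A lam mu"
  shows "simple_eigenvalue (d * n) 1 (pencil_coeffs (pencil_W0 n d W) (pencil_W1 n d W)) lam mu"
proof -
  define t where "t = det (V @\<^sub>r W)"
  let ?c = "\<lambda>z :: complex. [:[:z:]:]"
  have eq: "mpoly_det (d * n) 1 (pencil_coeffs (pencil_W0 n d W) (pencil_W1 n d W)) = ?c t * mpoly_det n d A"
  proof (rule bipoly_eqI)
    fix a b :: complex assume b: "b \<noteq> 0"
    show "poly (poly (mpoly_det (d * n) 1 (pencil_coeffs (pencil_W0 n d W) (pencil_W1 n d W))) [:a:]) b
        = poly (poly (?c t * mpoly_det n d A) [:a:]) b"
      using det_linearization[of d A n b W V a] A b W V VC WC
      unfolding poly_mpoly_det mpoly_eval_pencil_coeffs[OF pencil_carrier[OF W]] poly_mult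
      by (simp add: t_def poly_mpoly_det)
  qed
  have "?c (inverse t) * ?c t = 1" using det by (simp add: t_def one_pCons)
  then have "mpoly_det n d A = ?c (inverse t) * (?c t * mpoly_det n d A)"
    by (metis mult.assoc mult_1)
  then have "p dvd ?c t * mpoly_det n d A \<longleftrightarrow> p dvd mpoly_det n d A" for p
    by (metis dvd_mult)
  then show ?thesis
    using simple unfolding simple_eigenvalue_def simple_hom_root_def eq by simp
qed

section \<open>Eigenvectors of the linearization and the bound\<close>

text \<open>The adjoint of the row vector \<open>y\<^sup>* (\<lambda>\<^sup>i \<mu>\<^sup>d\<^sup>-\<^sup>i I)\<^sub>i\<close>; taking the adjoint is what conjugates
  the scalars.\<close>

definition lambda_row_kron :: "nat \<Rightarrow> nat \<Rightarrow> complex \<Rightarrow> complex \<Rightarrow> complex vec \<Rightarrow> complex vec" where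
  "lambda_row_kron n d lam mu y =
     vec ((d + 1) * n) (\<lambda>r. cnj (lam ^ (r div n) * mu ^ (d - r div n)) * y $ (r mod n))"

lemma lambda_row_kron_carrier: "lambda_row_kron n d lam mu y \<in> carrier_vec ((d + 1) * n)"
  by (simp add: lambda_row_kron_def)

lemma lambda_row_kron_block:
  assumes "i \<le> d" "k < n"
  shows "lambda_row_kron n d lam mu y $ (i * n + k) = cnj (lam ^ i * mu ^ (d - i)) * y $ k"
  using block_index_less[of i "d + 1" k n] assms by (simp add: lambda_row_kron_def)

lemma cscalar_lambda_row_kron:
  assumes "q \<in> carrier_vec ((d + 1) * n)"
  shows "q \<bullet>c lambda_row_kron n d lam mu y =
    (\<Sum>k<n. cnj (y $ k) * (\<Sum>i\<le>d. lam ^ i * mu ^ (d - i) * q $ (i * n + k)))"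
proof -
  let ?w = "lambda_row_kron n d lam mu y"
  have "q \<bullet>c ?w = (\<Sum>r<(d + 1) * n. q $ r * cnj (?w $ r))"
    using lambda_row_kron_carrier[of n d lam mu y]
    by (simp add: scalar_prod_def lessThan_atLeast0)
  also have "\<dots> = (\<Sum>k<n. \<Sum>i\<le>d. q $ (i * n + k) * cnj (?w $ (i * n + k)))"
    by (rule sum_blocks_Suc)
  also have "\<dots> = (\<Sum>k<n. cnj (y $ k) * (\<Sum>i\<le>d. lam ^ i * mu ^ (d - i) * q $ (i * n + k)))"
    by (intro sum.cong) (auto simp: lambda_row_kron_block sum_distrib_left mult_ac intro!: sum.cong)
  finally show ?thesis .
qed

lemma vec_norm2_square_blocks:
  assumes "v \<in> carrier_vec (m * n)"
  shows "(vec_norm2 v)\<^sup>2 = (\<Sum>i<m. \<Sum>k<n. (cmod (v $ (i * n + k)))\<^sup>2)"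
  unfolding vec_norm2_square using assms sum_blocks[of "\<lambda>r. (cmod (v $ r))\<^sup>2" m n] by simp

lemma lambda_row_kron_norm:
  assumes y: "y \<in> carrier_vec n"
  shows "vec_norm2 (lambda_row_kron n d lam mu y) = vec_norm2 (abs_Lambda d lam mu) * vec_norm2 y"
proof -
  have "(vec_norm2 (abs_Lambda d lam mu))\<^sup>2 = (\<Sum>i<d + 1. (cmod lam ^ (d - i) * cmod mu ^ i)\<^sup>2)"
    by (simp add: vec_norm2_square abs_Lambda_def norm_mult norm_power)
  also have "\<dots> = (\<Sum>i<d + 1. (cmod lam ^ i * cmod mu ^ (d - i))\<^sup>2)"
    by (rule sum.reindex_bij_witness[of _ "\<lambda>i. d - i" "\<lambda>i. d - i"]) auto
  finally have L: "(vec_norm2 (abs_Lambda d lam mu))\<^sup>2 = (\<Sum>i<d + 1. (cmod lam ^ i * cmod mu ^ (d - i))\<^sup>2)" .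
  have "(vec_norm2 (lambda_row_kron n d lam mu y))\<^sup>2 =
      (\<Sum>i<d + 1. \<Sum>k<n. (cmod lam ^ i * cmod mu ^ (d - i))\<^sup>2 * (cmod (y $ k))\<^sup>2)"
    unfolding vec_norm2_square_blocks[OF lambda_row_kron_carrier]
    by (intro sum.cong) (auto simp: lambda_row_kron_block norm_mult norm_power power_mult_distrib)
  also have "\<dots> = (vec_norm2 (abs_Lambda d lam mu) * vec_norm2 y)\<^sup>2"
    unfolding power_mult_distrib L using y
    by (simp add: vec_norm2_square sum_product del: sum.lessThan_Suc)
  finally show ?thesis
    by (rule power2_eq_imp_eq) (simp_all add: vec_norm2_nonneg)
qed

lemma lambda_row_kron_nonzero:
  assumes y: "y \<in> carrier_vec n" "y \<noteq> 0\<^sub>v n" and nz: "lam \<noteq> 0 \<or> mu \<noteq> 0"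
  shows "lambda_row_kron n d lam mu y \<noteq> 0\<^sub>v ((d + 1) * n)"
proof
  assume 0: "lambda_row_kron n d lam mu y = 0\<^sub>v ((d + 1) * n)"
  from y obtain k where k: "k < n" "y $ k \<noteq> 0" by (auto simp: vec_eq_iff)
  have "cnj (lam ^ i * mu ^ (d - i)) * y $ k = 0" if "i \<le> d" for i
    using lambda_row_kron_block[OF that k(1), of lam mu y] block_index_less[of i "d + 1" k n] that k(1)
    unfolding 0 by simp
  from this[of 0] this[of d] show False using k nz by simp
qed

lemma cscalar_coeff_column:
  assumes A: "\<And>i. i \<le> d \<Longrightarrow> A i \<in> carrier_mat n n" and v: "v \<in> carrier_vec n" and y: "y \<in> carrier_vec n"
  shows "(coeff_column n d A *\<^sub>v v) \<bullet>c lambda_row_kron n d lam mu y = bilin y (mpoly_eval n d A lam mu) v"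
proof -
  have ev: "mpoly_eval n d A lam mu \<in> carrier_mat n n" by (simp add: mpoly_eval_def)
  have "(coeff_column n d A *\<^sub>v v) \<bullet>c lambda_row_kron n d lam mu y
      = (\<Sum>k<n. cnj (y $ k) * (mpoly_eval n d A lam mu *\<^sub>v v) $ k)"
    using A v coeff_column_carrier[of n d A]
    by (subst cscalar_lambda_row_kron) (auto simp: mpoly_eval_mult_vec simp del: index_mult_mat_vec intro!: sum.cong)
  then show ?thesis by (simp add: bilin_sum[OF ev v y] mult.commute)
qed

lemma cscalar_shift_mat_zero:
  assumes v: "v \<in> carrier_vec (d * n)"
  shows "(shift_mat n d mu (- lam) *\<^sub>v v) \<bullet>c lambda_row_kron n d lam mu y = 0"
proof -
  have "(shift_mat n d mu (- lam) *\<^sub>v v) \<bullet>c lambda_row_kron n d lam mu y = (\<Sum>k<n. cnj (y $ k) *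
      (\<Sum>i\<le>d. lam ^ i * mu ^ (d - i) * (shift_mat n d mu (- lam) *\<^sub>v v) $ (i * n + k)))"
    using shift_mat_carrier[of n d mu "- lam"] v by (intro cscalar_lambda_row_kron) (metis mult_mat_vec_carrier)
  also have "\<dots> = (\<Sum>k<n. cnj (y $ k) * 0)"
  proof (rule sum.cong)
    fix k assume "k \<in> {..<n}"
    then have k: "k < n" by simp
    show "cnj (y $ k) * (\<Sum>i\<le>d. lam ^ i * mu ^ (d - i) * (shift_mat n d mu (- lam) *\<^sub>v v) $ (i * n + k))
        = cnj (y $ k) * 0"
      using hom_row_annihilates[of lam mu d "\<lambda>i. v $ (i * n + k)"]
      by (simp add: shift_mat_mult_vec_block[OF v _ k] del: index_mult_mat_vec)
  qed simp
  finally show ?thesis by simp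
qed

text \<open>The reason why both condition numbers have the same denominator: if \<open>G v = C x\<close>, the
  derivative of the matrix \<open>G\<close> paired with the undifferentiated row equals, up to sign, the
  derivative of the row paired with \<open>C x\<close>, and the latter is the derivative of \<open>A\<close> applied to \<open>x\<close>.\<close>

lemma cscalar_shift_mat_derivative:
  assumes A: "\<And>i. i \<le> d \<Longrightarrow> A i \<in> carrier_mat n n"
    and x: "x \<in> carrier_vec n" and y: "y \<in> carrier_vec n" and v: "v \<in> carrier_vec (d * n)"
    and eq: "shift_mat n d mu (- lam) *\<^sub>v v = coeff_column n d A *\<^sub>v x"
  shows "(shift_mat n d b a *\<^sub>v v) \<bullet>c lambda_row_kron n d lam mu y
    = bilin y (a \<cdot>\<^sub>m D_lam n d A lam mu - b \<cdot>\<^sub>m D_mu n d A lam mu) x"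
proof -
  let ?D = "a \<cdot>\<^sub>m D_lam n d A lam mu - b \<cdot>\<^sub>m D_mu n d A lam mu"
  have D: "?D \<in> carrier_mat n n" by (intro minus_carrier_mat smult_carrier_mat) (simp add: D_mu_def)
  have "(shift_mat n d b a *\<^sub>v v) \<bullet>c lambda_row_kron n d lam mu y = (\<Sum>k<n. cnj (y $ k) *
      (\<Sum>i\<le>d. lam ^ i * mu ^ (d - i) * (shift_mat n d b a *\<^sub>v v) $ (i * n + k)))"
    using shift_mat_carrier[of n d b a] v by (intro cscalar_lambda_row_kron) (metis mult_mat_vec_carrier)
  also have "\<dots> = (\<Sum>k<n. cnj (y $ k) * (?D *\<^sub>v x) $ k)"
  proof (rule sum.cong)
    fix k assume "k \<in> {..<n}"
    then have k: "k < n" by simp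
    have "(?D *\<^sub>v x) $ k = (\<Sum>i\<le>d. (a * (of_nat i * lam ^ (i - 1) * mu ^ (d - i))
              - b * (lam ^ i * (of_nat (d - i) * mu ^ (d - i - 1)))) *
            (shift_mat n d mu (- lam) *\<^sub>v v) $ (i * n + k))"
      unfolding eq using A x k by (rule derivative_combination_mult_vec)
    also have "\<dots> = (\<Sum>i\<le>d. lam ^ i * mu ^ (d - i) * (shift_mat n d b a *\<^sub>v v) $ (i * n + k))"
      using hom_row_derivative[of a lam mu d b "\<lambda>i. v $ (i * n + k)"]
      by (simp add: shift_mat_mult_vec_block[OF v _ k] del: index_mult_mat_vec)
    finally show "cnj (y $ k) * (\<Sum>i\<le>d. lam ^ i * mu ^ (d - i) * (shift_mat n d b a *\<^sub>v v) $ (i * n + k))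
        = cnj (y $ k) * (?D *\<^sub>v x) $ k" by simp
  qed simp
  finally show ?thesis by (simp add: bilin_sum[OF D x y] mult.commute)
qed

text \<open>The system decouples: for each position \<open>k\<close> inside the blocks it is a scalar bidiagonal
  system. Thus the bound for scalar systems carries over without change.\<close>

lemma shift_mat_solve:
  assumes d: "d \<ge> 1" and nrm: "(cmod lam)\<^sup>2 + (cmod mu)\<^sup>2 = 1" and q: "q \<in> carrier_vec ((d + 1) * n)"
    and 0: "\<And>k. k < n \<Longrightarrow> (\<Sum>i\<le>d. lam ^ i * mu ^ (d - i) * q $ (i * n + k)) = 0"
  obtains v where "v \<in> carrier_vec (d * n)" "shift_mat n d mu (- lam) *\<^sub>v v = q"
    "vec_norm2 v \<le> sqrt 2 * tri_norm d * vec_norm2 q"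
proof -
  have "\<forall>k<n. \<exists>z. (\<forall>i\<le>d. mu * (if i = 0 then 0 else z (i - 1)) - lam * (if i < d then z i else 0) = q $ (i * n + k)) \<and>
       (\<Sum>j<d. (cmod (z j))\<^sup>2) \<le> 2 * (tri_norm d)\<^sup>2 * (\<Sum>i\<le>d. (cmod (q $ (i * n + k)))\<^sup>2)"
  proof (intro allI impI)
    fix k assume "k < n"
    from bidiagonal_solve[OF d nrm 0[OF this]]
    show "\<exists>z. (\<forall>i\<le>d. mu * (if i = 0 then 0 else z (i - 1)) - lam * (if i < d then z i else 0) = q $ (i * n + k)) \<and>
       (\<Sum>j<d. (cmod (z j))\<^sup>2) \<le> 2 * (tri_norm d)\<^sup>2 * (\<Sum>i\<le>d. (cmod (q $ (i * n + k)))\<^sup>2)" .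
  qed
  then obtain z where
    z: "\<And>k i. k < n \<Longrightarrow> i \<le> d \<Longrightarrow>
        mu * (if i = 0 then 0 else z k (i - 1)) - lam * (if i < d then z k i else 0) = q $ (i * n + k)"
    and zb: "\<And>k. k < n \<Longrightarrow>
        (\<Sum>j<d. (cmod (z k j))\<^sup>2) \<le> 2 * (tri_norm d)\<^sup>2 * (\<Sum>i\<le>d. (cmod (q $ (i * n + k)))\<^sup>2)"
    by metis
  define v where "v = vec (d * n) (\<lambda>r. z (r mod n) (r div n))"
  have v: "v \<in> carrier_vec (d * n)" by (simp add: v_def)
  have v_block: "v $ (i * n + k) = z k i" if "i < d" "k < n" for i k
    using block_index_less[OF that] that by (simp add: v_def)
  have "shift_mat n d mu (- lam) *\<^sub>v v = q"
  proof (rule eq_vecI)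
    fix r assume "r < dim_vec q"
    then have r: "r < (d + 1) * n" using q by simp
    then have "n > 0" by (cases n) auto
    then have k: "r mod n < n" by simp
    have i: "r div n \<le> d" using r by (metis less_Suc_eq_le less_mult_imp_div_less Suc_eq_plus1)
    have "(shift_mat n d mu (- lam) *\<^sub>v v) $ (i * n + k) = q $ (i * n + k)"
      if "i \<le> d" "k < n" for i k
      unfolding shift_mat_mult_vec_block[OF v that] z[OF that(2,1), symmetric]
      using that by (auto simp: v_block)
    from this[OF i k]
    show "(shift_mat n d mu (- lam) *\<^sub>v v) $ r = q $ r" by (simp only: div_mult_mod_eq)
  qed (use shift_mat_carrier[of n d mu "- lam"] q in simp)
  moreover have "(vec_norm2 v)\<^sup>2 \<le> (sqrt 2 * tri_norm d * vec_norm2 q)\<^sup>2"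
  proof -
    have "(vec_norm2 v)\<^sup>2 = (\<Sum>k<n. \<Sum>j<d. (cmod (z k j))\<^sup>2)"
      unfolding vec_norm2_square_blocks[OF v] by (subst sum.swap) (simp add: v_block)
    also have "\<dots> \<le> (\<Sum>k<n. 2 * (tri_norm d)\<^sup>2 * (\<Sum>i\<le>d. (cmod (q $ (i * n + k)))\<^sup>2))"
      using zb by (intro sum_mono) auto
    also have "\<dots> = 2 * (tri_norm d)\<^sup>2 * (vec_norm2 q)\<^sup>2"
      unfolding vec_norm2_square_blocks[OF q] Suc_eq_plus1[symmetric] lessThan_Suc_atMost
        sum_distrib_left[symmetric]
      by (subst sum.swap) simp
    finally show ?thesis by (simp add: power_mult_distrib)
  qed
  then have "vec_norm2 v \<le> sqrt 2 * tri_norm d * vec_norm2 q"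
    by (rule power2_le_imp_le) (simp add: tri_norm_nonneg vec_norm2_nonneg)
  ultimately show thesis using that v by blast
qed

lemma sum_lessThan_add:
  fixes f :: "nat \<Rightarrow> 'a :: comm_monoid_add"
  shows "(\<Sum>i<m + n. f i) = (\<Sum>i<m. f i) + (\<Sum>i<n. f (m + i))"
  by (induction n) (simp_all add: add.assoc)

lemma vec_norm2_append:
  "(vec_norm2 (u @\<^sub>v v))\<^sup>2 = (vec_norm2 u)\<^sup>2 + (vec_norm2 v)\<^sup>2"
  by (simp add: vec_norm2_square sum_lessThan_add)

text \<open>\<open>W0\<close> and \<open>W1\<close> are the contraction \<open>W\<close> composed with isometries that pad by zeros.\<close>

lemma pencil_weight_orthonormal_le:
  assumes W: "W \<in> carrier_mat m ((d + 1) * n)" and orth: "orthonormal_rows W"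
    and nrm: "(cmod lam)\<^sup>2 + (cmod mu)\<^sup>2 = 1"
  shows "pencil_weight (pencil_W0 n d W) (pencil_W1 n d W) lam mu \<le> 1"
proof -
  have zero: "vec_norm2 (0\<^sub>v n) = 0" by (simp add: vec_norm2_def)
  have pad: "vec_norm2 (0\<^sub>v n @\<^sub>v v) = vec_norm2 v" "vec_norm2 (v @\<^sub>v 0\<^sub>v n) = vec_norm2 v" for v
    using vec_norm2_append[of "0\<^sub>v n" v] vec_norm2_append[of v "0\<^sub>v n"] vec_norm2_nonneg
    by (simp_all add: zero power2_eq_iff_nonneg)
  have sq: "(spectral_norm (W * S))\<^sup>2 \<le> 1"
    if S: "S \<in> carrier_mat ((d + 1) * n) (d * n)"
      and iso: "\<And>v. v \<in> carrier_vec (d * n) \<Longrightarrow> vec_norm2 (S *\<^sub>v v) = vec_norm2 v" for S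
  proof -
    have "spectral_norm (W * S) \<le> 1"
    proof (rule spectral_norm_le)
      fix v :: "complex vec" assume "v \<in> carrier_vec (dim_col (W * S))"
      then have v: "v \<in> carrier_vec (d * n)" using S by simp
      have "vec_norm2 ((W * S) *\<^sub>v v) = vec_norm2 (W *\<^sub>v (S *\<^sub>v v))"
        using W S v by simp
      also have "\<dots> \<le> vec_norm2 (S *\<^sub>v v)"
        using W S v by (intro orthonormal_rows_norm_le[OF orth]) auto
      finally show "vec_norm2 ((W * S) *\<^sub>v v) \<le> 1 * vec_norm2 v" using iso[OF v] by simp
    qed simp
    then show ?thesis using spectral_norm_nonneg[of "W * S"] by (simp add: power_le_one)
  qed
  have W0: "(spectral_norm (pencil_W0 n d W))\<^sup>2 \<le> 1"
    unfolding pencil_W0_def by (rule sq[OF shift_blocks_carrier(1)]) (simp add: shift_block_mult_vec pad)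
  have W1: "(spectral_norm (pencil_W1 n d W))\<^sup>2 \<le> 1"
    unfolding pencil_W1_def by (rule sq[OF shift_blocks_carrier(2)]) (simp add: shift_block_mult_vec pad)
  have "(cmod lam)\<^sup>2 * (spectral_norm (pencil_W1 n d W))\<^sup>2 + (cmod mu)\<^sup>2 * (spectral_norm (pencil_W0 n d W))\<^sup>2
      \<le> (cmod lam)\<^sup>2 * 1 + (cmod mu)\<^sup>2 * 1"
    using W0 W1 by (intro add_mono mult_left_mono) auto
  then show ?thesis unfolding pencil_weight_def using nrm by simp
qed

theorem mainTheorem3:
  fixes n d :: nat
    and A :: "nat \<Rightarrow> complex mat"
    and W V B :: "complex mat"
    and lam mu :: complex
    and x y :: "complex vec"
  assumes "n \<ge> 1" and "d \<ge> 1"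
    and "\<And>i. i \<le> d \<Longrightarrow> A i \<in> carrier_mat n n"
    and "nonsingular_mpoly n d A"
    and "W \<in> carrier_mat (d * n) ((d + 1) * n)"
    and "vec_space.rank (d * n) W = d * n"
    and "W * coeff_column n d A = 0\<^sub>m (d * n) n"
    and "V \<in> carrier_mat n ((d + 1) * n)"
    and "B \<in> carrier_mat ((d + 1) * n) (d * n)"
    and "(V @\<^sub>r W) * (coeff_column n d A @\<^sub>c B) = 1\<^sub>m ((d + 1) * n)"
    and "(cmod lam)\<^sup>2 + (cmod mu)\<^sup>2 = 1"
    and "simple_eigenvalue n d A lam mu"
    and "right_eigenvector (mpoly_eval n d A lam mu) x"
    and "left_eigenvector (mpoly_eval n d A lam mu) y"
  shows "eigenvalue_cond (pencil_W0 n d W) (pencil_W1 n d W) lam mu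
           \<le> pencil_weight (pencil_W0 n d W) (pencil_W1 n d W) lam mu * sqrt 2 * tri_norm d
              * vec_norm2 (abs_Lambda d lam mu) * spectral_norm (coeff_column n d A) * spectral_norm B
              * (vec_norm2 x * vec_norm2 y
                  / cmod (bilin y (cnj mu \<cdot>\<^sub>m D_lam n d A lam mu - cnj lam \<cdot>\<^sub>m D_mu n d A lam mu) x))
       \<and> (orthonormal_rows W \<longrightarrow>
           eigenvalue_cond (pencil_W0 n d W) (pencil_W1 n d W) lam mu
             \<le> sqrt 2 * tri_norm d
                * vec_norm2 (abs_Lambda d lam mu) * spectral_norm (coeff_column n d A)
                * (vec_norm2 x * vec_norm2 y
                    / cmod (bilin y (cnj mu \<cdot>\<^sub>m D_lam n d A lam mu - cnj lam \<cdot>\<^sub>m D_mu n d A lam mu) x)))"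
proof -
  note d = assms(2) and A = assms(3) and W = assms(5) and V = assms(8) and B = assms(9)
    and nrm = assms(11) and simple = assms(12)
  let ?C = "coeff_column n d A" and ?E = "mpoly_eval n d A lam mu"
  let ?W0 = "pencil_W0 n d W" and ?W1 = "pencil_W1 n d W"
  let ?S = "shift_mat n d mu (- lam)" and ?w = "lambda_row_kron n d lam mu y"
  have N: "(d + 1) * n = n + d * n" by simp
  note C = coeff_column_carrier[of n d A] and S = shift_mat_carrier[of n d mu "- lam"]
    and w = lambda_row_kron_carrier[of n d lam mu y]
  note blocks = biorthogonal_blocks[of ?C n "d * n" W V B, folded N, OF C W V B assms(10)]
  have ev: "?E \<in> carrier_mat n n" by (simp add: mpoly_eval_def)
  have x: "x \<in> carrier_vec n" "x \<noteq> 0\<^sub>v n" "?E *\<^sub>v x = 0\<^sub>v n"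
    using assms(13) ev unfolding right_eigenvector_def by auto
  have y: "y \<in> carrier_vec n" "y \<noteq> 0\<^sub>v n" "adj_mult_vec ?E y = 0\<^sub>v n"
    using assms(14) ev unfolding left_eigenvector_iff by auto
  have nz: "lam \<noteq> 0 \<or> mu \<noteq> 0" using nrm by auto
  have Cx: "?C *\<^sub>v x \<in> carrier_vec ((d + 1) * n)" using C x(1) by (rule mult_mat_vec_carrier)
  have "(\<Sum>i\<le>d. lam ^ i * mu ^ (d - i) * (?C *\<^sub>v x) $ (i * n + k)) = 0" if "k < n" for k
    using mpoly_eval_mult_vec[of d A n x k lam mu] A x that by simp
  from shift_mat_solve[OF d nrm Cx this] obtain v where
    v: "v \<in> carrier_vec (d * n)" "?S *\<^sub>v v = ?C *\<^sub>v x"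
    and v_norm: "vec_norm2 v \<le> sqrt 2 * tri_norm d * vec_norm2 (?C *\<^sub>v x)" by blast
  define u where "u = adj_mult_vec B ?w"
  have u: "u \<in> carrier_vec (d * n)" using adj_mult_vec_carrier[of B ?w] B by (simp add: u_def)
  have C_ortho: "(?C *\<^sub>v t) \<bullet>c ?w = 0" if t: "t \<in> carrier_vec n" for t
  proof -
    have "(?C *\<^sub>v t) \<bullet>c ?w = (?E *\<^sub>v t) \<bullet>c y"
      using cscalar_coeff_column[of d A n t y lam mu] A t y(1) by (simp add: bilin_def)
    also have "\<dots> = t \<bullet>c adj_mult_vec ?E y" using ev t y(1) by (rule cscalar_adj)
    finally show ?thesis using t by (simp add: y(3))
  qed
  have Wu: "(W *\<^sub>v q) \<bullet>c u = q \<bullet>c ?w" if q: "q \<in> carrier_vec ((d + 1) * n)" for q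
  proof -
    have Wq: "W *\<^sub>v q \<in> carrier_vec (d * n)" and Vq: "V *\<^sub>v q \<in> carrier_vec n"
      using W V q by (blast intro: mult_mat_vec_carrier)+
    have "q = (?C * V + B * W) *\<^sub>v q" unfolding blocks(2) using q by simp
    also have "\<dots> = ?C *\<^sub>v (V *\<^sub>v q) + B *\<^sub>v (W *\<^sub>v q)"
      using C V B W q
      by (subst add_mult_distrib_mat_vec[of _ "(d + 1) * n" "(d + 1) * n"]) auto
    finally have "q \<bullet>c ?w = (?C *\<^sub>v (V *\<^sub>v q) + B *\<^sub>v (W *\<^sub>v q)) \<bullet>c ?w" by simp
    also have "\<dots> = (?C *\<^sub>v (V *\<^sub>v q)) \<bullet>c ?w + (B *\<^sub>v (W *\<^sub>v q)) \<bullet>c ?w"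
      using C B Wq Vq w by (intro add_scalar_prod_distrib[of _ "(d + 1) * n"]) auto
    also have "\<dots> = (W *\<^sub>v q) \<bullet>c u"
      using C_ortho[OF Vq] cscalar_adj[OF B Wq w] by (simp add: u_def)
    finally show ?thesis by simp
  qed
  have WSu: "((W * shift_mat n d b a) *\<^sub>v t) \<bullet>c u = (shift_mat n d b a *\<^sub>v t) \<bullet>c ?w"
    if t: "t \<in> carrier_vec (d * n)" for a b t
  proof -
    have St: "shift_mat n d b a *\<^sub>v t \<in> carrier_vec ((d + 1) * n)"
      using shift_mat_carrier t by (rule mult_mat_vec_carrier)
    have "(W * shift_mat n d b a) *\<^sub>v t = W *\<^sub>v (shift_mat n d b a *\<^sub>v t)"
      using W shift_mat_carrier t by (rule assoc_mult_mat_vec)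
    then show ?thesis using Wu[OF St] by simp
  qed
  have adj_W_u: "adj_mult_vec W u = ?w" using W u w Wu by (rule adj_mult_vec_eqI)
  have WS: "W * ?S \<in> carrier_mat (d * n) (d * n)" using W S by (rule mult_carrier_mat)
  have pencil: "mu \<cdot>\<^sub>m ?W0 - lam \<cdot>\<^sub>m ?W1 = W * ?S" using W by (rule pencil_eq_mult_shift)
  have right: "right_eigenvector (mu \<cdot>\<^sub>m ?W0 - lam \<cdot>\<^sub>m ?W1) v"
  proof -
    have "v \<noteq> 0\<^sub>v (d * n)"
    proof
      assume "v = 0\<^sub>v (d * n)"
      then have "?S *\<^sub>v v = 0\<^sub>v ((d + 1) * n)" using S by (auto intro!: eq_vecI)
      then have "?C *\<^sub>v x = 0\<^sub>v ((d + 1) * n)" unfolding v(2) .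
      then have "V *\<^sub>v (?C *\<^sub>v x) = 0\<^sub>v n" using V by (auto intro!: eq_vecI)
      moreover have "V *\<^sub>v (?C *\<^sub>v x) = x"
        using assoc_mult_mat_vec[OF V C x(1)] x(1) by (simp add: blocks(1))
      ultimately show False using x by simp
    qed
    moreover have "(W * ?S) *\<^sub>v v = 0\<^sub>v (d * n)"
    proof -
      have "(W * ?S) *\<^sub>v v = W *\<^sub>v (?C *\<^sub>v x)"
        unfolding v(2)[symmetric] using W S v(1) by (rule assoc_mult_mat_vec)
      also have "\<dots> = (W * ?C) *\<^sub>v x" using assoc_mult_mat_vec[OF W C x(1)] by simp
      finally show ?thesis unfolding assms(7) using x(1) by (auto intro!: eq_vecI)
    qed
    ultimately show ?thesis unfolding pencil right_eigenvector_def using W S v(1) by simp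
  qed
  have left: "left_eigenvector (mu \<cdot>\<^sub>m ?W0 - lam \<cdot>\<^sub>m ?W1) u"
  proof -
    have "u \<noteq> 0\<^sub>v (d * n)"
    proof
      assume "u = 0\<^sub>v (d * n)"
      then have "adj_mult_vec W u = 0\<^sub>v ((d + 1) * n)"
        using W by (auto simp: adj_mult_vec_def intro!: eq_vecI)
      then show False using lambda_row_kron_nonzero[OF y(1,2) nz, of d] by (simp add: adj_W_u)
    qed
    moreover have "adj_mult_vec (W * ?S) u = 0\<^sub>v (d * n)"
      by (rule adj_mult_vec_eqI[OF WS u]) (simp_all add: WSu cscalar_shift_mat_zero)
    ultimately show ?thesis unfolding pencil left_eigenvector_iff using W S u by simp
  qed
  have "cnj mu \<cdot>\<^sub>m ?W1 + cnj lam \<cdot>\<^sub>m ?W0 = W * shift_mat n d (cnj lam) (cnj mu)"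
    unfolding mult_shift_mat[OF W] using pencil_carrier[OF W]
    by (intro comm_add_mat smult_carrier_mat) auto
  then have denominator: "bilin u (cnj mu \<cdot>\<^sub>m ?W1 + cnj lam \<cdot>\<^sub>m ?W0) v
      = bilin y (cnj mu \<cdot>\<^sub>m D_lam n d A lam mu - cnj lam \<cdot>\<^sub>m D_mu n d A lam mu) x" (is "_ = ?den")
    using WSu[OF v(1)] cscalar_shift_mat_derivative[OF A x(1) y(1) v] by (simp add: bilin_def)
  have cond: "eigenvalue_cond ?W0 ?W1 lam mu
      = pencil_weight ?W0 ?W1 lam mu * (vec_norm2 v * vec_norm2 u / cmod ?den)"
    using eigenvalue_cond_eq[OF pencil_carrier[OF W] nrm _ right left]
      simple_eigenvalue_linearization[OF A W V blocks(1) assms(7) blocks(3) simple]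
    by (simp add: denominator)
  have weight: "0 \<le> pencil_weight ?W0 ?W1 lam mu" by (simp add: pencil_weight_def)
  note nonneg = vec_norm2_nonneg spectral_norm_nonneg tri_norm_nonneg
  have Cx_norm: "vec_norm2 (?C *\<^sub>v x) \<le> spectral_norm ?C * vec_norm2 x"
    using x(1) C by (intro spectral_norm_bound) simp
  have v_le: "vec_norm2 v \<le> sqrt 2 * tri_norm d * (spectral_norm ?C * vec_norm2 x)"
    by (rule order_trans[OF v_norm mult_left_mono[OF Cx_norm]]) (simp add: nonneg)
  have bound: "eigenvalue_cond ?W0 ?W1 lam mu
      \<le> p * ((sqrt 2 * tri_norm d * (spectral_norm ?C * vec_norm2 x)) * q / cmod ?den)"
    if "pencil_weight ?W0 ?W1 lam mu \<le> p" "vec_norm2 u \<le> q" for p q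
    unfolding cond using that weight v_le order_trans[OF vec_norm2_nonneg that(2)]
    by (intro mult_mono divide_right_mono) (auto simp: nonneg)
  show ?thesis
  proof (intro conjI impI)
    have "vec_norm2 u \<le> spectral_norm B * (vec_norm2 (abs_Lambda d lam mu) * vec_norm2 y)"
      using adj_mult_vec_norm_le[of ?w B] w B by (simp add: u_def lambda_row_kron_norm[OF y(1)])
    from bound[OF order_refl this] show "eigenvalue_cond ?W0 ?W1 lam mu
        \<le> pencil_weight ?W0 ?W1 lam mu * sqrt 2 * tri_norm d * vec_norm2 (abs_Lambda d lam mu)
            * spectral_norm ?C * spectral_norm B * (vec_norm2 x * vec_norm2 y / cmod ?den)"
      by (simp add: mult_ac)
  next
    assume orth: "orthonormal_rows W"
    have "vec_norm2 u = vec_norm2 (abs_Lambda d lam mu) * vec_norm2 y"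
      using orthonormal_rows_adj_norm[OF orth, of u] u W
      by (simp add: adj_W_u lambda_row_kron_norm[OF y(1)])
    from bound[OF pencil_weight_orthonormal_le[OF W orth nrm] eq_refl[OF this]]
    show "eigenvalue_cond ?W0 ?W1 lam mu
        \<le> sqrt 2 * tri_norm d * vec_norm2 (abs_Lambda d lam mu) * spectral_norm ?C
            * (vec_norm2 x * vec_norm2 y / cmod ?den)"
      by (simp add: mult_ac)
  qed
qed

end
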